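(* Let $K_1\subseteq K_2\subseteq\mathbb{R}^n$ be two smooth convex bodies. Then $$\xi(K_1)\ \le\ \xi(K_2),$$ where $\xi(K)$ denotes the length of the shortest periodic billiard trajectory in $K$.
   Context: A convex body in $\mathbb{R}^n$ is a compact convex set with non-empty interior; it is smooth if its boundary is smooth. Periodic billiard trajectories (this notion includes gliding trajectories along the boundary). Let $K\subset\mathbb{R}^n_q$ be a smooth convex body, translated so that $0\in \mathrm{int}(K)$ (all notions are translation invariant), and let $B\subset\mathbb{R}^n_p$ be the closed Euclidean unit ball. Let $g_K(q)=\inf\{r>0 : q\in rK\}$ and $g_B(p)=|p|$. A loop $\gamma:S^1\to\mathbb{R}^{2n}=\mathbb{R}^n_q\times\mathbb{R}^n_p$ is piecewise smooth if it is continuous, has left and right derivatives at all points, and is smooth outside some measure-zero subset of $S^1$. A closed $(K,B)$-billiard trajectory is (the image of) a piecewise smooth map $\gamma=(q,p):S^1\to\partial(K\times B)$ such that, with $\mathcal{B}_\gamma=\{t\in S^1: \gamma(t)\in\partial K\times\partial B\}$: (i) there is a constant $d>0$ such that for every $t\notin\mathcal{B}_\gamma$, $\dot\gamma(t)=d\,(-\nabla g_B(p(t)),0)$ if $\gamma(t)\in \mathrm{int}(K)\times\partial B$, and $\dot\gamma(t)=d\,(0,\nabla g_K(q(t)))$ if $\gamma(t)\in\partial K\times \mathrm{int}(B)$; (ii) for every $t\in\mathcal{B}_\gamma$ the left and right derivatives $\dot\gamma^{\pm}(t)$ each belong to $\{\alpha(-\nabla g_B(p(t)),0)+\beta(0,\nabla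 g_K(q(t))) : \alpha,\beta\ge 0,\ (\alpha,\beta)\ne(0,0)\}$. A periodic billiard trajectory in $K$ is the closed curve $q$ (the projection of such a $\gamma$ to $\mathbb{R}^n_q$), and its length is its Euclidean length. $\xi(K)$ is the minimum of the lengths of all periodic billiard trajectories in $K$. *)

theory Defs
  imports "HOL-Analysis.Analysis"
begin

definition convex_body :: "'a::euclidean_space set \<Rightarrow> bool" where
  "convex_body K \<longleftrightarrow> compact K \<and> convex K \<and> interior K \<noteq> {}"

(* Class C^k on an open set S; derivatives of order k + 1 are expressed through
   the directional derivatives x |-> Df(x) v, which keeps the type of f fixed. *)
primrec Ck_on :: "nat \<Rightarrow> ('a::real_normed_vector \<Rightarrow> 'b::real_normed_vector) \<Rightarrow> 'a set \<Rightarrow> bool" where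
  "Ck_on 0 f S \<longleftrightarrow> continuous_on S f"
| "Ck_on (Suc k) f S \<longleftrightarrow> (\<forall>x\<in>S. f differentiable (at x)) \<and>
     (\<forall>v. Ck_on k (\<lambda>x. frechet_derivative f (at x) v) S)"

definition smooth_on :: "('a::real_normed_vector \<Rightarrow> 'b::real_normed_vector) \<Rightarrow> 'a set \<Rightarrow> bool" where
  "smooth_on f S \<longleftrightarrow> (\<forall>k. Ck_on k f S)"

(* Embedded C^infinity hypersurface: locally the zero set of a smooth function
   with non-vanishing differential. *)
definition smooth_hypersurface :: "'a::euclidean_space set \<Rightarrow> bool" where
  "smooth_hypersurface M \<longleftrightarrow> (\<forall>x\<in>M. \<exists>U (f :: 'a \<Rightarrow> real). open U \<and> x \<in> U \<and> smooth_on f U \<and>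
     (\<forall>y\<in>U. frechet_derivative f (at y) \<noteq> (\<lambda>_. 0)) \<and> M \<inter> U = {y \<in> U. f y = 0})"

definition smooth_convex_body :: "'a::euclidean_space set \<Rightarrow> bool" where
  "smooth_convex_body K \<longleftrightarrow> convex_body K \<and> smooth_hypersurface (frontier K)"

definition gauge_fun :: "'a::euclidean_space set \<Rightarrow> 'a \<Rightarrow> real" where
  "gauge_fun K q = Inf {r. r > 0 \<and> q \<in> (\<lambda>x. r *\<^sub>R x) ` K}"

definition grad :: "('a::euclidean_space \<Rightarrow> real) \<Rightarrow> 'a \<Rightarrow> 'a" where
  "grad f x = (THE D. GDERIV f x :> D)"

(* Loops, i.e. maps on the circle R/Z, are represented by 1-periodic maps on R. The period
   is immaterial: rescaling time only changes the constant d in the billiard equations. *)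
definition loop :: "(real \<Rightarrow> 'a) \<Rightarrow> bool" where
  "loop \<gamma> \<longleftrightarrow> (\<forall>t. \<gamma> (t + 1) = \<gamma> t)"

definition piecewise_smooth :: "(real \<Rightarrow> 'a::real_normed_vector) \<Rightarrow> bool" where
  "piecewise_smooth \<gamma> \<longleftrightarrow> continuous_on UNIV \<gamma> \<and>
     (\<forall>t. (\<exists>D. (\<gamma> has_vector_derivative D) (at_left t)) \<and>
          (\<exists>D. (\<gamma> has_vector_derivative D) (at_right t))) \<and>
     negligible {t. \<not> (\<exists>U. open U \<and> t \<in> U \<and> smooth_on \<gamma> U)}"

definition billiard_cone :: "'a::euclidean_space set \<Rightarrow> 'a \<times> 'a \<Rightarrow> ('a \<times> 'a) set" where
  "billiard_cone K z =
     {\<alpha> *\<^sub>R (- grad norm (snd z), 0) + \<beta> *\<^sub>R (0, grad (gauge_fun K) (fst z)) | \<alpha> \<beta>.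
        \<alpha> \<ge> 0 \<and> \<beta> \<ge> 0 \<and> (\<alpha>, \<beta>) \<noteq> (0, 0)}"

(* Closed (K,B)-billiard trajectories, B = cball 0 1 the closed Euclidean unit ball (whose
   gauge is the norm). Meaningful when 0 is an interior point of K. *)
definition closed_billiard_trajectory ::
    "'a::euclidean_space set \<Rightarrow> (real \<Rightarrow> 'a \<times> 'a) \<Rightarrow> bool" where
  "closed_billiard_trajectory K \<gamma> \<longleftrightarrow>
     loop \<gamma> \<and> piecewise_smooth \<gamma> \<and> (\<forall>t. \<gamma> t \<in> frontier (K \<times> cball 0 1)) \<and>
     (\<exists>d>0. \<forall>t. \<gamma> t \<notin> frontier K \<times> frontier (cball 0 1) \<longrightarrow>
        (\<gamma> t \<in> interior K \<times> frontier (cball 0 1) \<longrightarrow>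
           (\<gamma> has_vector_derivative d *\<^sub>R (- grad norm (snd (\<gamma> t)), 0)) (at t)) \<and>
        (\<gamma> t \<in> frontier K \<times> interior (cball 0 1) \<longrightarrow>
           (\<gamma> has_vector_derivative d *\<^sub>R (0, grad (gauge_fun K) (fst (\<gamma> t)))) (at t))) \<and>
     (\<forall>t. \<gamma> t \<in> frontier K \<times> frontier (cball 0 1) \<longrightarrow>
        (\<exists>D\<in>billiard_cone K (\<gamma> t). (\<gamma> has_vector_derivative D) (at_left t)) \<and>
        (\<exists>D\<in>billiard_cone K (\<gamma> t). (\<gamma> has_vector_derivative D) (at_right t)))"

(* For general K, an interior point x of K is first translated to the origin. Another choice
   of x multiplies the gradient of the gauge at each boundary point by a positive factor,
   hence changes gamma only by a reparametrization. *)
definition periodic_billiard_trajectory ::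
    "'a::euclidean_space set \<Rightarrow> (real \<Rightarrow> 'a) \<Rightarrow> bool" where
  "periodic_billiard_trajectory K q \<longleftrightarrow>
     (\<exists>x\<in>interior K. \<exists>p. closed_billiard_trajectory ((\<lambda>y. y - x) ` K) (\<lambda>t. (q t - x, p t)))"

(* Euclidean length over one period: supremum of the lengths of inscribed polygons. *)
definition loop_length :: "(real \<Rightarrow> 'a::metric_space) \<Rightarrow> ennreal" where
  "loop_length q = (SUP ts \<in> {ts. sorted ts \<and> set ts \<subseteq> {0..1}}.
     \<Sum>i<length ts - 1. ennreal (dist (q (ts ! i)) (q (ts ! Suc i))))"

(* LEAST rather than the infimum: xi is the minimum of the lengths. *)
definition xi :: "'a::euclidean_space set \<Rightarrow> ennreal" where
  "xi K = (LEAST l. \<exists>q. periodic_billiard_trajectory K q \<and> l = loop_length q)"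

end

theory Submission
  imports Defs
begin

text \<open>Let \<open>m(K)\<close> be the least length of a closed polygon with at most \<open>n + 1\<close> vertices whose vertex set has
  no translate inside the interior of \<open>K\<close>; clearly \<open>m\<close> is monotone in \<open>K\<close>, and it turns out to be \<open>\<xi>(K)\<close>.
  A billiard trajectory \<open>(q, p)\<close> cannot be translated into the interior, since \<open>p \<bullet> v\<close> would be monotone
  for the translation vector \<open>v\<close>; by Helly's theorem its length is at least \<open>m(K)\<close>. Conversely, a minimal
  polygon with the fewest vertices touches the boundary in points whose normals are positively dependent.
  It minimises the length under one linear constraint, whose Lagrange condition is the reflection law.
  Since no gliding occurs along it, it is an honest billiard trajectory of length \<open>m(K)\<close>.\<close>

section \<open>Tangent cones and the gauge of a smooth convex body\<close>

text \<open>Competing polygons need not have their vertices on the boundary, or even in the body.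
  Shrinking the body therefore only adds competitors, whereas a trajectory in the larger body is in
  general no trajectory in the smaller one. The bound \<open>n + 1\<close> on the number of vertices
  is the Helly number of dimension \<open>n\<close>; with it, polygons stay within finitely many
  sizes and a minimiser exists. Smoothness enters in first-order form. The last clause of
  \<open>supporting_normal\<close> says that the tangent cone at \<open>q\<close> is a whole
  half-space, uniformly over directions that stay away from the tangent hyperplane. This makes the
  gauge differentiable at \<open>q\<close> and lets a contact point be pushed inward along every
  direction with negative normal component. Since \<open>xi\<close> is a \<open>LEAST\<close>, a
  lower bound for all lengths is not enough: the bound has to be attained, so the minimal polygon is
  turned into an explicit curve in phase space with one-sided derivatives at every time.\<close>

definition supporting_normal :: "'a::euclidean_space set \<Rightarrow> 'a \<Rightarrow> 'a \<Rightarrow> bool" where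
  "supporting_normal K q w \<longleftrightarrow> w \<noteq> 0 \<and> (\<forall>y\<in>K. w \<bullet> (y - q) \<le> 0) \<and>
     (\<forall>\<epsilon>>0. \<exists>\<delta>>0. \<forall>h. h \<noteq> 0 \<and> norm h < \<delta> \<and> w \<bullet> h \<le> - \<epsilon> * norm h \<longrightarrow> q + h \<in> interior K)"

text \<open>The cone is a strict sublevel set of the convex function
  \<open>w \<bullet> h + e * norm h\<close>. Convexity is what later makes a translate of the cone
  connected.\<close>

lemma convex_truncated_cone:
  fixes w :: "'a::real_inner"
  assumes "0 \<le> e"
  shows "convex {h. norm h < d \<and> w \<bullet> h < - e * norm h}"
proof (rule convexI)
  fix x y :: 'a and u v :: real
  assume x: "x \<in> {h. norm h < d \<and> w \<bullet> h < - e * norm h}" and y: "y \<in> {h. norm h < d \<and> w \<bullet> h < - e * norm h}"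
    and uv: "0 \<le> u" "0 \<le> v" "u + v = 1"
  have n: "norm (u *\<^sub>R x + v *\<^sub>R y) \<le> u * norm x + v * norm y"
    using norm_triangle_ineq[of "u *\<^sub>R x" "v *\<^sub>R y"] uv by simp
  have 1: "u * norm x + v * norm y < d"
    using convex_bound_lt[of "norm x" d "norm y" u v] x y uv by simp
  have "u * (w \<bullet> x + e * norm x) + v * (w \<bullet> y + e * norm y) < 0"
    using convex_bound_lt[of "w \<bullet> x + e * norm x" 0 "w \<bullet> y + e * norm y" u v] x y uv by simp
  moreover have "e * norm (u *\<^sub>R x + v *\<^sub>R y) \<le> e * (u * norm x + v * norm y)"
    using n assms by (rule mult_left_mono)
  ultimately have "w \<bullet> (u *\<^sub>R x + v *\<^sub>R y) < - e * norm (u *\<^sub>R x + v *\<^sub>R y)"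
    by (simp add: inner_add_right algebra_simps)
  with n 1 show "u *\<^sub>R x + v *\<^sub>R y \<in> {h. norm h < d \<and> w \<bullet> h < - e * norm h}" by simp
qed

text \<open>The cone condition alone forces the supporting inequality: if some \<open>y\<close> in
  \<open>K\<close> lay beyond the hyperplane, the opposite direction would enter the interior, and
  \<open>q\<close> would lie strictly between \<open>y\<close> and an interior point.\<close>

lemma supporting_normalI:
  fixes K :: "'a::euclidean_space set"
  assumes K: "convex K" and q: "q \<in> frontier K" and w: "w \<noteq> 0"
    and cone: "\<And>\<epsilon>. \<epsilon> > 0 \<Longrightarrow> \<exists>\<delta>>0. \<forall>h. h \<noteq> 0 \<and> norm h < \<delta> \<and> w \<bullet> h \<le> - \<epsilon> * norm h \<longrightarrow> q + h \<in> interior K"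
  shows "supporting_normal K q w"
  unfolding supporting_normal_def
proof (intro conjI w ballI allI impI cone)
  fix y assume y: "y \<in> K"
  show "w \<bullet> (y - q) \<le> 0"
  proof (rule ccontr)
    assume "\<not> w \<bullet> (y - q) \<le> 0"
    then have pos: "w \<bullet> (y - q) > 0" and n: "norm (y - q) > 0" by auto
    define \<epsilon> where "\<epsilon> = w \<bullet> (y - q) / norm (y - q)"
    have e: "\<epsilon> > 0" and ee: "w \<bullet> (y - q) = \<epsilon> * norm (y - q)" using pos n by (auto simp: \<epsilon>_def)
    obtain \<delta> where d: "\<delta> > 0"
      and D: "\<And>h. h \<noteq> 0 \<Longrightarrow> norm h < \<delta> \<Longrightarrow> w \<bullet> h \<le> - \<epsilon> * norm h \<Longrightarrow> q + h \<in> interior K"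
      using cone[OF e] by blast
    define t where "t = \<delta> / (2 * norm (y - q))"
    have t: "t > 0" "t * norm (y - q) < \<delta>" using d n by (auto simp: t_def)
    have "q + (- t) *\<^sub>R (y - q) \<in> interior K"
      using t n ee by (intro D) auto
    \<comment> \<open>The point \<open>q\<close> divides the segment from \<open>y\<close> to
      \<open>q - t (y - q)\<close> in the ratio \<open>1 : t\<close>; this brings it into the shape
      expected by \<open>mem_interior_convex_shrink\<close>.\<close>
    moreover have "q = y - (t / (1 + t) + 1 / (1 + t)) *\<^sub>R (y - q)"
      using t by (simp add: add_divide_distrib[symmetric] add.commute)
    then have "q = y - (1 / (1 + t)) *\<^sub>R (y - (q + (- t) *\<^sub>R (y - q)))"
      using t by (simp add: algebra_simps scaleR_left_distrib[symmetric] add_divide_distrib[symmetric])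
    moreover have "y - (1 / (1 + t)) *\<^sub>R (y - (q + (- t) *\<^sub>R (y - q))) \<in> interior K"
      using t calculation(1) y by (intro mem_interior_convex_shrink K) auto
    ultimately show False using q by (metis DiffE frontier_def)
  qed
qed

text \<open>The thin cones on both sides of the tangent hyperplane avoid the boundary, so each lies inside
  or outside \<open>K\<close>; a segment towards an interior point decides which one lies inside.\<close>
lemma smooth_convex_body_supporting_normal:
  fixes K :: "'a::euclidean_space set"
  assumes K: "smooth_convex_body K" and q: "q \<in> frontier K"
  shows "\<exists>w. supporting_normal K q w"
proof -
  have cK: "convex K" and "compact K" and iK: "interior K \<noteq> {}"
    using K by (auto simp: smooth_convex_body_def convex_body_def)
  then have qK: "q \<in> K" using q compact_imp_closed frontier_subset_closed by blast
  from K q obtain U and f :: "'a \<Rightarrow> real" where U: "open U" "q \<in> U" and sm: "smooth_on f U"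
    and nz: "frechet_derivative f (at q) \<noteq> (\<lambda>_. 0)" and fr: "frontier K \<inter> U = {y \<in> U. f y = 0}"
    unfolding smooth_convex_body_def smooth_hypersurface_def by blast
  have "Ck_on (Suc 0) f U" using sm unfolding smooth_on_def by blast
  then have df: "f differentiable (at q)" using U by simp
  define D where "D = frechet_derivative f (at q)"
  have hd: "(f has_derivative D) (at q)" using df unfolding D_def by (simp add: frechet_derivative_works)
  have lin: "linear D" using hd by (rule has_derivative_linear)
  define w0 where "w0 = adjoint D 1"
  have D: "D h = w0 \<bullet> h" for h using adjoint_works[OF lin, of h 1] by (simp add: w0_def inner_commute)
  have w0: "w0 \<noteq> 0" using nz D by (auto simp: D_def)
  have f0: "f q = 0" using fr q U by blast
  \<comment> \<open>An interior point on the tangent hyperplane is moved slightly along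
    \<open>w0\<close>, which leaves the hyperplane but not the interior.\<close>
  obtain z where z: "z \<in> interior K" "w0 \<bullet> (z - q) \<noteq> 0"
  proof -
    obtain z where zi: "z \<in> interior K" using iK by blast
    show thesis
    proof (cases "w0 \<bullet> (z - q) = 0")
      case True
      obtain r where r: "r > 0" "ball z r \<subseteq> interior K" using zi open_interior open_contains_ball by blast
      define y where "y = z + (r / (2 * norm w0)) *\<^sub>R w0"
      have "dist z y < r" using r w0 by (simp add: y_def dist_norm)
      then have "y \<in> interior K" using r by auto
      moreover have "w0 \<bullet> (y - q) = r / (2 * norm w0) * (w0 \<bullet> w0)"
        using True by (simp add: y_def algebra_simps inner_add_right)
      ultimately show thesis using that r w0 by auto
    qed (use zi that in blast)
  qed
  define \<sigma> where "\<sigma> = - sgn (w0 \<bullet> (z - q))"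
  have s: "\<bar>\<sigma>\<bar> = 1" "\<sigma> \<noteq> 0" using z by (auto simp: \<sigma>_def abs_sgn_eq sgn_eq_0_iff)
  define w where "w = \<sigma> *\<^sub>R w0"
  have wz: "w \<bullet> (z - q) < 0" using z by (auto simp: w_def \<sigma>_def sgn_if)
  have w: "w \<noteq> 0" using w0 s by (auto simp: w_def)
  have zq: "norm (z - q) > 0" using wz by auto
  \<comment> \<open>Half the slope of \<open>z - q\<close> against \<open>w\<close>, so that the
    direction towards \<open>z\<close> lies in the open cone for every
    \<open>e \<le> e0\<close>.\<close>
  define e0 where "e0 = - (w \<bullet> (z - q)) / (2 * norm (z - q))"
  have e0: "e0 > 0" using wz zq by (simp add: e0_def divide_neg_pos del: zero_less_norm_iff)
  have small: "\<exists>\<delta>>0. \<forall>h. norm h < \<delta> \<and> w \<bullet> h < - e * norm h \<longrightarrow> q + h \<in> interior K" if e: "e > 0" "e \<le> e0" for e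
  proof -
    obtain r where r: "r > 0" "ball q r \<subseteq> U" using U open_contains_ball by blast
    obtain d where d: "d > 0" "\<And>y. norm (y - q) < d \<Longrightarrow> norm (f y - f q - D (y - q)) \<le> e * norm (y - q)"
      using hd e unfolding has_derivative_at_alt by blast
    define \<delta> where "\<delta> = min r d"
    have del: "\<delta> > 0" using r d by (simp add: \<delta>_def)
    define C where "C = {h. norm h < \<delta> \<and> w \<bullet> h < - e * norm h}"
    have nf: "q + h \<notin> frontier K" if h: "h \<in> C" for h
    proof
      assume a: "q + h \<in> frontier K"
      have "q + h \<in> U" using h r by (auto simp: C_def \<delta>_def dist_norm)
      then have "f (q + h) = 0" using a fr by blast
      then have "\<bar>w0 \<bullet> h\<bar> \<le> e * norm h"
        using d(2)[of "q + h"] h f0 by (auto simp: C_def \<delta>_def D)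
      moreover have "\<bar>w \<bullet> h\<bar> = \<bar>w0 \<bullet> h\<bar>" using s by (simp add: w_def abs_mult)
      ultimately show False using h by (auto simp: C_def)
    qed
    define t where "t = min (1/2) (\<delta> / (2 * norm (z - q)))"
    have t: "0 < t" "t \<le> 1" "t * norm (z - q) < \<delta>"
    proof -
      have "t * norm (z - q) \<le> \<delta> / (2 * norm (z - q)) * norm (z - q)"
        using zq by (intro mult_right_mono) (auto simp: t_def)
      also have "\<dots> < \<delta>" using zq del by simp
      finally show "t * norm (z - q) < \<delta>" .
    qed (use zq del in \<open>auto simp: t_def\<close>)
    have "w \<bullet> (z - q) < - e * norm (z - q)"
    proof -
      have "e * norm (z - q) \<le> e0 * norm (z - q)" using e zq by simp
      also have "\<dots> = - (w \<bullet> (z - q)) / 2" using zq by (simp add: e0_def)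
      finally show ?thesis using wz by simp
    qed
    then have "t * (w \<bullet> (z - q)) < t * (- e * norm (z - q))" using t by (intro mult_strict_left_mono) auto
  then have "t *\<^sub>R (z - q) \<in> C" using t by (simp add: C_def mult.left_commute)
    moreover have "q + t *\<^sub>R (z - q) \<in> K"
      using convexD_alt[OF cK qK, of z t] z interior_subset t by (auto simp: algebra_simps)
    ultimately have ne: "(+) q ` C \<inter> K \<noteq> {}" by blast
    have "convex C" unfolding C_def using e by (intro convex_truncated_cone) simp
    then have "connected ((+) q ` C)" by (intro convex_connected convex_translation)
    then have "(+) q ` C \<subseteq> K" using connected_Int_frontier[of "(+) q ` C" K] ne nf by blast
    then have "q + h \<in> interior K" if "h \<in> C" for h
      using nf[OF that] that closure_subset[of K] unfolding frontier_def by blast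
    then show ?thesis using del by (auto simp: C_def)
  qed
  have "\<exists>\<delta>>0. \<forall>h. h \<noteq> 0 \<and> norm h < \<delta> \<and> w \<bullet> h \<le> - \<epsilon> * norm h \<longrightarrow> q + h \<in> interior K" if e: "\<epsilon> > 0" for \<epsilon>
  proof -
    \<comment> \<open>Since \<open>e\<close> is strictly below \<open>\<epsilon>\<close>, the closed
      cone of slope \<open>\<epsilon>\<close> without its apex lies in the open cone of slope
      \<open>e\<close> supplied by \<open>small\<close>.\<close>
    define e where "e = min (\<epsilon> / 2) e0"
    have e': "e > 0" "e \<le> e0" "e < \<epsilon>" using e e0 by (auto simp: e_def)
    obtain \<delta> where d: "\<delta> > 0" "\<And>h. norm h < \<delta> \<Longrightarrow> w \<bullet> h < - e * norm h \<Longrightarrow> q + h \<in> interior K"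
      using small[OF e'(1,2)] by blast
    have "q + h \<in> interior K" if h: "h \<noteq> 0" "norm h < \<delta>" "w \<bullet> h \<le> - \<epsilon> * norm h" for h
    proof (rule d(2)[OF h(2)])
      have "e * norm h < \<epsilon> * norm h" using e' h by (intro mult_strict_right_mono) auto
      then show "w \<bullet> h < - e * norm h" using h(3) unfolding mult_minus_left by linarith
    qed
    then show ?thesis using d by blast
  qed
  then show ?thesis using supporting_normalI[OF cK q w] by blast
qed

lemma frontier_diff_translation:
  fixes K :: "'a::euclidean_space set"
  shows "frontier ((\<lambda>y. y - x) ` K) = (\<lambda>y. y - x) ` frontier K"
  using frontier_translation[of "- x" K] by simp

lemma interior_diff_translation:
  fixes K :: "'a::euclidean_space set"
  shows "interior ((\<lambda>y. y - x) ` K) = (\<lambda>y. y - x) ` interior K"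
  using interior_translation[of "- x" K] by simp

lemma supporting_normal_translation:
  fixes K :: "'a::euclidean_space set"
  assumes "supporting_normal K q w"
  shows "supporting_normal ((\<lambda>y. y - x) ` K) (q - x) w"
  unfolding supporting_normal_def interior_diff_translation
proof (intro conjI ballI allI impI)
  fix y assume "y \<in> (\<lambda>y. y - x) ` K"
  then show "w \<bullet> (y - (q - x)) \<le> 0" using assms by (auto simp: supporting_normal_def)
next
  fix \<epsilon> :: real assume "\<epsilon> > 0"
  then obtain \<delta> where d: "\<delta> > 0"
      and D: "\<And>h. h \<noteq> 0 \<Longrightarrow> norm h < \<delta> \<Longrightarrow> w \<bullet> h \<le> - \<epsilon> * norm h \<Longrightarrow> q + h \<in> interior K"
    using assms unfolding supporting_normal_def by meson
  have "q - x + h \<in> (\<lambda>y. y - x) ` interior K" if "q + h \<in> interior K" for h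
    by (rule image_eqI[OF _ that]) simp
  with d D show "\<exists>\<delta>>0. \<forall>h. h \<noteq> 0 \<and> norm h < \<delta> \<and> w \<bullet> h \<le> - \<epsilon> * norm h \<longrightarrow> q - x + h \<in> (\<lambda>y. y - x) ` interior K"
    by blast
qed (use assms in \<open>auto simp: supporting_normal_def\<close>)

section \<open>The gauge and its gradient\<close>

lemma gauge_fun_le:
  assumes "r > 0" "y \<in> (\<lambda>x. r *\<^sub>R x) ` K"
  shows "gauge_fun K y \<le> r"
  unfolding gauge_fun_def using assms by (intro cInf_lower) (auto intro: bdd_belowI[of _ 0])

lemma gauge_fun_ge:
  fixes K :: "'a::euclidean_space set"
  assumes 0: "0 \<in> interior K" and s: "\<And>y. y \<in> K \<Longrightarrow> s \<bullet> y \<le> 1"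
  shows "s \<bullet> y \<le> gauge_fun K y"
  unfolding gauge_fun_def
proof (rule cInf_greatest)
  obtain e where e: "e > 0" "cball 0 e \<subseteq> K" using 0 mem_interior_cball by blast
  \<comment> \<open>Chosen so that \<open>y / r\<close> has norm at most \<open>e\<close>; the
    summand 1 keeps \<open>r\<close> positive for \<open>y = 0\<close>. The infimum is thus taken
    over a non-empty set.\<close>
  define r where "r = (norm y + 1) / e"
  have r: "r > 0" using e by (simp add: r_def add_nonneg_pos)
  have "e * r = norm y + 1" using e by (simp add: r_def)
  then have "norm y / r \<le> e" using r by (simp add: pos_divide_le_eq)
  then have "inverse r *\<^sub>R y \<in> K" using e r by (auto simp: divide_inverse mult.commute)
  moreover have "y = r *\<^sub>R (inverse r *\<^sub>R y)" using r by simp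
  ultimately show "{r. 0 < r \<and> y \<in> (\<lambda>x. r *\<^sub>R x) ` K} \<noteq> {}" using r by blast
next
  fix r assume "r \<in> {r. 0 < r \<and> y \<in> (\<lambda>x. r *\<^sub>R x) ` K}"
  then obtain x where "r > 0" "x \<in> K" "y = r *\<^sub>R x" by blast
  then show "s \<bullet> y \<le> r" using s[of x] by simp
qed

lemma grad_eqI:
  fixes f :: "'a::euclidean_space \<Rightarrow> real"
  assumes "GDERIV f x :> D"
  shows "grad f x = D"
  unfolding grad_def
proof (rule the_equality[of _ D])
  fix E assume "GDERIV f x :> E"
  then have "(\<lambda>h. h \<bullet> E) = (\<lambda>h. h \<bullet> D)" using assms has_derivative_unique unfolding gderiv_def by blast
  then have "(E - D) \<bullet> E = (E - D) \<bullet> D" by metis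
  then show "E = D" by (metis inner_diff_right inner_eq_zero_iff right_minus_eq)
qed (rule assms)

lemma grad_norm_unit: "norm (p::'a::euclidean_space) = 1 \<Longrightarrow> grad norm p = p"
  by (rule grad_eqI) (use GDERIV_norm[of p] in \<open>cases "p = 0"; auto simp: sgn_div_norm\<close>)

lemma supporting_normal_inward:
  fixes K :: "'a::euclidean_space set"
  assumes "supporting_normal K q w" "w \<bullet> v < 0"
  shows "\<exists>\<tau>>0. \<forall>t. 0 < t \<and> t < \<tau> \<longrightarrow> q + t *\<^sub>R v \<in> interior K"
proof -
  have v: "norm v > 0" using assms by auto
  define e where "e = - (w \<bullet> v) / norm v"
  have "e > 0" using assms v by (simp add: e_def divide_neg_pos del: zero_less_norm_iff)
  then obtain \<delta> where d: "\<delta> > 0"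
      and D: "\<And>h. h \<noteq> 0 \<Longrightarrow> norm h < \<delta> \<Longrightarrow> w \<bullet> h \<le> - e * norm h \<Longrightarrow> q + h \<in> interior K"
    using assms unfolding supporting_normal_def by meson
  show ?thesis
  proof (intro exI[of _ "\<delta> / norm v"] conjI allI impI)
    fix t assume t: "0 < t \<and> t < \<delta> / norm v"
    show "q + t *\<^sub>R v \<in> interior K"
    proof (rule D)
      show "norm (t *\<^sub>R v) < \<delta>" using t v by (simp add: pos_less_divide_eq)
      show "w \<bullet> t *\<^sub>R v \<le> - e * norm (t *\<^sub>R v)" using t v by (simp add: e_def)
    qed (use t v in auto)
  qed (use d v in auto)
qed

text \<open>With \<open>s = w / (w \<bullet> q)\<close>, the linear function \<open>s\<close> is a
  lower bound of the gauge that is exact at \<open>q\<close>. For the upper bound,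
  \<open>q + h\<close> divided by \<open>r = 1 + s \<bullet> h + \<epsilon> * norm h\<close> lies
  below the tangent hyperplane with a definite slope, so the cone condition places it in
  \<open>K\<close> and the gauge is at most \<open>r\<close>.\<close>

lemma gauge_gradient:
  fixes K :: "'a::euclidean_space set"
  assumes K: "closed K" and 0: "0 \<in> interior K" and q: "q \<in> frontier K" and w: "supporting_normal K q w"
  shows "w \<bullet> q > 0" and "GDERIV (gauge_fun K) q :> (1 / (w \<bullet> q)) *\<^sub>R w"
proof -
  have w0: "w \<noteq> 0" and le: "\<And>y. y \<in> K \<Longrightarrow> w \<bullet> y \<le> w \<bullet> q"
    using w by (auto simp: supporting_normal_def inner_diff_right)
  obtain e where e: "e > 0" "cball 0 e \<subseteq> K" using 0 mem_interior_cball by blast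
  have "(e / norm w) *\<^sub>R w \<in> K" using e w0 by auto
  from le[OF this] have "e / norm w * (w \<bullet> w) \<le> w \<bullet> q" by simp
  moreover have "e / norm w * (w \<bullet> w) > 0" using e w0 by simp
  ultimately show wq: "w \<bullet> q > 0" by linarith
  define s where "s = (1 / (w \<bullet> q)) *\<^sub>R w"
  have sq: "s \<bullet> q = 1" using wq by (simp add: s_def)
  have s1: "s \<bullet> y \<le> 1" if "y \<in> K" for y using le[OF that] wq by (simp add: s_def)
  have qK: "q \<in> K" using q K frontier_subset_closed by blast
  have ge: "s \<bullet> y \<le> gauge_fun K y" for y by (rule gauge_fun_ge[OF 0 s1])
  have "gauge_fun K q \<le> 1" by (rule gauge_fun_le) (use qK in auto)
  then have g1: "gauge_fun K q = 1" using ge[of q] sq by linarith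
  have "GDERIV (gauge_fun K) q :> s"
    unfolding gderiv_def has_derivative_at_alt
  proof (intro conjI allI impI)
    show "bounded_linear (\<lambda>h. h \<bullet> s)" by (rule bounded_linear_inner_left)
    fix \<epsilon> :: real assume ep: "\<epsilon> > 0"
    \<comment> \<open>Bounds the displacement: with \<open>k\<close> as below,
      \<open>r * norm k \<le> C * norm h\<close>. Hence \<open>\<epsilon> / C\<close> is the slope
      at which the cone condition is invoked.\<close>
    define C where "C = 1 + norm s * norm q + \<epsilon> * norm q"
    have C: "C > 0" using ep by (simp add: C_def add_pos_nonneg)
    obtain \<delta> where d: "\<delta> > 0"
      and D: "\<And>h. h \<noteq> 0 \<Longrightarrow> norm h < \<delta> \<Longrightarrow> w \<bullet> h \<le> - ((w \<bullet> q) * \<epsilon> / C) * norm h \<Longrightarrow> q + h \<in> interior K"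
      using w wq ep C unfolding supporting_normal_def
      by (metis (no_types, lifting) divide_pos_pos mult_pos_pos)
    \<comment> \<open>The first bound gives \<open>\<bar>s \<bullet> h\<bar> \<le> 1/2\<close> and
      so \<open>r > 1/2\<close>; the second then gives \<open>norm k < \<delta>\<close>.\<close>
    define d' where "d' = min (1 / (2 * (norm s + 1))) (\<delta> / (2 * C))"
    have d': "d' > 0" using d C by (simp add: d'_def add_nonneg_pos)
    have "norm (gauge_fun K y - gauge_fun K q - (y - q) \<bullet> s) \<le> \<epsilon> * norm (y - q)" if y: "norm (y - q) < d'" for y
    proof (cases "y = q")
      case False
      define h where "h = y - q"
      have yq: "y = q + h" and h: "norm h > 0" "norm h < d'" using y False by (auto simp: h_def)
      have "\<bar>s \<bullet> h\<bar> \<le> norm s * norm h" by (rule Cauchy_Schwarz_ineq2)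
      also have "\<dots> \<le> (norm s + 1) * (1 / (2 * (norm s + 1)))"
        using h by (intro mult_mono) (auto simp: d'_def)
      also have "\<dots> = 1/2"
      proof -
        have "a * (1 / (2 * a)) = 1/2" if "a \<noteq> 0" for a :: real using that by simp
        moreover have "norm s + 1 \<noteq> 0" using norm_ge_zero[of s] by linarith
        ultimately show ?thesis by blast
      qed
      finally have sh: "\<bar>s \<bullet> h\<bar> \<le> 1/2" .
      define r where "r = 1 + s \<bullet> h + \<epsilon> * norm h"
      have "\<epsilon> * norm h > 0" using ep h by (intro mult_pos_pos)
      then have r: "r > 1/2" using sh unfolding r_def by linarith
      \<comment> \<open>This is \<open>y / r - q\<close>; the term
        \<open>\<epsilon> * norm h\<close> in \<open>r\<close> makes \<open>s \<bullet> k\<close>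
        negative.\<close>
      define k where "k = (1 / r) *\<^sub>R (h - (s \<bullet> h + \<epsilon> * norm h) *\<^sub>R q)"
      have rk: "r *\<^sub>R k = h - (s \<bullet> h + \<epsilon> * norm h) *\<^sub>R q" using r by (simp add: k_def)
      have yk: "y = r *\<^sub>R (q + k)"
        by (simp add: scaleR_add_right rk yq) (simp add: r_def algebra_simps)
      have "r * (s \<bullet> k) = s \<bullet> (r *\<^sub>R k)" by simp
      also have "\<dots> = - \<epsilon> * norm h" unfolding rk by (simp add: inner_diff_right sq)
      finally have sk: "r * (s \<bullet> k) = - \<epsilon> * norm h" .
      have "norm (r *\<^sub>R k) \<le> norm h + norm ((s \<bullet> h + \<epsilon> * norm h) *\<^sub>R q)" unfolding rk by (rule norm_triangle_ineq4)
      also have "norm ((s \<bullet> h + \<epsilon> * norm h) *\<^sub>R q) \<le> (norm s * norm h + \<epsilon> * norm h) * norm q"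
        unfolding norm_scaleR using Cauchy_Schwarz_ineq2[of s h] ep
        by (intro mult_right_mono) (auto intro: order_trans[OF abs_triangle_ineq])
      finally have nk: "r * norm k \<le> C * norm h" using r by (simp add: C_def algebra_simps)
      have "q + k \<in> interior K"
      proof (rule D)
        show "k \<noteq> 0" using sk h ep by auto
        have "norm k / 2 \<le> r * norm k" using r mult_right_mono[of "1/2" r "norm k"] by simp
        also have "\<dots> \<le> C * norm h" by (rule nk)
        also have "\<dots> < C * (\<delta> / (2 * C))" using h C by (intro mult_strict_left_mono) (auto simp: d'_def)
        also have "\<dots> = \<delta> / 2" using C by simp
        finally show "norm k < \<delta>" by simp
        have "r * (s \<bullet> k) \<le> r * (- (\<epsilon> / C) * norm k)"
        proof -
          have "\<epsilon> / C * (r * norm k) \<le> \<epsilon> / C * (C * norm h)" using nk ep C by (intro mult_left_mono) auto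
          then show ?thesis using C sk by (simp add: algebra_simps)
        qed
        then have "s \<bullet> k \<le> - (\<epsilon> / C) * norm k" by (rule mult_left_le_imp_le) (use r in simp)
        then have "(w \<bullet> q) * (s \<bullet> k) \<le> (w \<bullet> q) * (- (\<epsilon> / C) * norm k)" using wq by (intro mult_left_mono) auto
        moreover have "(w \<bullet> q) * (s \<bullet> k) = w \<bullet> k" using wq by (simp add: s_def)
        ultimately show "w \<bullet> k \<le> - (w \<bullet> q * \<epsilon> / C) * norm k" by simp
      qed
      then have "y \<in> (\<lambda>x. r *\<^sub>R x) ` K" using yk interior_subset by blast
      then have "gauge_fun K y \<le> r" using r by (intro gauge_fun_le) auto
      moreover have "s \<bullet> y = 1 + s \<bullet> h" using yq sq by (simp add: inner_add_right)
      ultimately show ?thesis using ge[of y] g1 by (simp add: r_def h_def inner_commute)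
    qed simp
    then show "\<exists>d>0. \<forall>y. norm (y - q) < d \<longrightarrow> norm (gauge_fun K y - gauge_fun K q - (y - q) \<bullet> s) \<le> \<epsilon> * norm (y - q)"
      using d' by blast
  qed
  then show "GDERIV (gauge_fun K) q :> (1 / (w \<bullet> q)) *\<^sub>R w" by (simp add: s_def)
qed

text \<open>Asking for the interior makes failure to fit a closed condition on finite tuples of
  points, so that minimal polygons exist, and lets a polygon contained in \<open>K\<close> still
  fail to fit by touching the boundary.\<close>

definition fits_inside :: "'a::euclidean_space set \<Rightarrow> 'a set \<Rightarrow> bool" where
  "fits_inside S K \<longleftrightarrow> (\<exists>v. \<forall>x\<in>S. x + v \<in> interior K)"

lemma fits_inside_mono: "fits_inside T K \<Longrightarrow> S \<subseteq> T \<Longrightarrow> interior K \<subseteq> interior L \<Longrightarrow> fits_inside S L"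
  unfolding fits_inside_def by blast

text \<open>Smoothness is recorded through supporting normals because these pass to translates
  directly; the origin is interior so that the gauge makes sense.\<close>

locale billiard_table =
  fixes K :: "'a::euclidean_space set"
  assumes convex: "convex K" and compact: "compact K" and zero: "0 \<in> interior K"
    and normal: "q \<in> frontier K \<Longrightarrow> \<exists>w. supporting_normal K q w"
begin

abbreviation g where "g \<equiv> grad (gauge_fun K)"

lemma closed: "closed K"
  using compact compact_imp_closed by blast

lemma grad_gauge:
  assumes q: "q \<in> frontier K"
  shows "g q \<bullet> q = 1" and "y \<in> interior K \<Longrightarrow> g q \<bullet> y < 1"
    and "g q \<bullet> v < 0 \<Longrightarrow> \<exists>\<tau>>0. \<forall>t. 0 < t \<and> t < \<tau> \<longrightarrow> q + t *\<^sub>R v \<in> interior K"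
proof -
  obtain w where w: "supporting_normal K q w" using normal q by blast
  note G = gauge_gradient[OF closed zero q w]
  have gq: "g q = (1 / (w \<bullet> q)) *\<^sub>R w" using G(2) by (rule grad_eqI)
  show s1: "g q \<bullet> q = 1" using G gq by simp
  show "\<exists>\<tau>>0. \<forall>t. 0 < t \<and> t < \<tau> \<longrightarrow> q + t *\<^sub>R v \<in> interior K" if "g q \<bullet> v < 0"
    using supporting_normal_inward[OF w, of v] that G gq by (simp add: divide_less_0_iff)
  have le: "g q \<bullet> y \<le> 1" if "y \<in> K" for y
    using w that G gq by (auto simp: supporting_normal_def inner_diff_right)
  assume y: "y \<in> interior K"
  obtain e where e: "e > 0" "cball y e \<subseteq> K" using y mem_interior_cball by blast
  have g0: "norm (g q) > 0" using s1 by auto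
  \<comment> \<open>Moving \<open>y\<close> within \<open>K\<close> along \<open>g q\<close> raises
    the functional, which turns the bound \<open>\<le> 1\<close> into a strict one at
    \<open>y\<close>.\<close>
  have "y + (e / norm (g q)) *\<^sub>R g q \<in> K" using e g0 by (auto simp: dist_norm)
  from le[OF this] have "g q \<bullet> y + e / norm (g q) * (g q \<bullet> g q) \<le> 1" by (simp add: inner_add_right)
  moreover have "e / norm (g q) * (g q \<bullet> g q) > 0" using e g0 by simp
  ultimately show "g q \<bullet> y < 1" by linarith
qed

end

lemma billiard_table_translation:
  fixes K :: "'a::euclidean_space set"
  assumes K: "smooth_convex_body K" and x: "x \<in> interior K"
  shows "billiard_table ((\<lambda>y. y - x) ` K)"
proof
  have "convex K" "compact K" using K by (auto simp: smooth_convex_body_def convex_body_def)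
  then show "convex ((\<lambda>y. y - x) ` K)" "compact ((\<lambda>y. y - x) ` K)"
    using convex_translation[of K "-x"] compact_translation[of K "-x"] by auto
  show "0 \<in> interior ((\<lambda>y. y - x) ` K)" using x by (auto simp: interior_diff_translation image_iff)
  fix q assume "q \<in> frontier ((\<lambda>y. y - x) ` K)"
  then obtain y where "y \<in> frontier K" "q = y - x" by (auto simp: frontier_diff_translation)
  then show "\<exists>w. supporting_normal ((\<lambda>y. y - x) ` K) q w"
    using smooth_convex_body_supporting_normal[OF K] supporting_normal_translation by blast
qed

section \<open>Trajectories cannot be translated into the interior\<close>

text \<open>A negative left derivative produces larger values just before each point, so the maximum
  over \<open>{a..b}\<close> can only be attained at \<open>a\<close>. The one-sided form is what
  trajectories provide at their corners.\<close>

lemma left_derivative_neg_imp_decreasing: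
  fixes f :: "real \<Rightarrow> real"
  assumes cont: "continuous_on UNIV f" and "a < b"
    and der: "\<And>t. \<exists>D<0. (f has_vector_derivative D) (at_left t)"
  shows "f b < f a"
proof -
  have less: "\<exists>s. a \<le> s \<and> s < c \<and> f c < f s" if c: "a < c" for c
  proof -
    obtain D where D: "D < 0" "(f has_vector_derivative D) (at_left c)" using der by blast
    have "((\<lambda>s. (f s - f c) / (s - c)) \<longlongrightarrow> D) (at_left c)"
      using D(2) unfolding has_real_derivative_iff_has_vector_derivative[symmetric] has_field_derivative_iff .
    then have "eventually (\<lambda>s. (f s - f c) / (s - c) < 0) (at_left c)"
      using D(1) by (rule order_tendstoD(2))
    moreover have "eventually (\<lambda>s. s \<in> {a<..<c}) (at_left c)" using c by (rule eventually_at_left_real)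
    ultimately have "eventually (\<lambda>s. s \<in> {a<..<c} \<and> (f s - f c) / (s - c) < 0) (at_left c)"
      by (rule eventually_conj[rotated])
    then obtain s where s: "s \<in> {a<..<c}" "(f s - f c) / (s - c) < 0"
      using eventually_happens trivial_limit_at_left_real by blast
    then have "f c < f s" by (simp add: divide_less_0_iff)
    then show ?thesis using s by (intro exI[of _ s]) auto
  qed
  obtain m where m: "m \<in> {a..b}" "\<And>s. s \<in> {a..b} \<Longrightarrow> f s \<le> f m"
    using continuous_attains_sup[of "{a..b}" f] continuous_on_subset[OF cont] \<open>a < b\<close> by auto
  have "m = a"
  proof (rule ccontr)
    assume "m \<noteq> a"
    then obtain s where "a \<le> s" "s < m" "f m < f s" using less[of m] m by auto
    then show False using m(2)[of s] m(1) by auto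
  qed
  moreover obtain s where "a \<le> s" "s < b" "f b < f s" using less \<open>a < b\<close> by blast
  ultimately show ?thesis using m(2)[of s] by auto
qed

text \<open>Subtracting a small linear term makes the derivative negative; its slope is chosen to
  cost exactly \<open>e\<close> over the interval.\<close>

lemma left_derivative_nonpos_imp_nonincreasing:
  fixes f :: "real \<Rightarrow> real"
  assumes cont: "continuous_on UNIV f" and "a \<le> b"
    and der: "\<And>t. \<exists>D\<le>0. (f has_vector_derivative D) (at_left t)"
  shows "f b \<le> f a"
proof (rule field_le_epsilon)
  fix e :: real assume e: "e > 0"
  show "f b \<le> f a + e"
  proof (cases "a = b")
    case False
    with \<open>a \<le> b\<close> have ab: "a < b" by simp
    define k where "k = e / (b - a)"
    have k: "k > 0" using e ab by (simp add: k_def)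
    have "f b + (- k) *\<^sub>R b < f a + (- k) *\<^sub>R a"
    proof (rule left_derivative_neg_imp_decreasing[OF _ ab])
      show "continuous_on UNIV (\<lambda>t. f t + (- k) *\<^sub>R t)" using cont by (intro continuous_intros)
      fix t
      obtain D where D: "D \<le> 0" "(f has_vector_derivative D) (at_left t)" using der by blast
      have "((\<lambda>t. f t + (- k) *\<^sub>R t) has_vector_derivative D + (- k) *\<^sub>R 1) (at_left t)"
        by (intro derivative_intros D(2) bounded_linear.has_vector_derivative[OF bounded_linear_scaleR_right])
      moreover have "D + (- k) *\<^sub>R 1 < 0" using D k by simp
      ultimately show "\<exists>D<0. ((\<lambda>t. f t + (- k) *\<^sub>R t) has_vector_derivative D) (at_left t)" by blast
    qed
    then have "f b < f a + k * (b - a)" by (simp add: algebra_simps)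
    also have "k * (b - a) = e" using ab by (simp add: k_def)
    finally show ?thesis by simp
  qed (use e in simp)
qed

lemma loop_add_nat:
  assumes "loop f"
  shows "f (t + real n) = f t"
proof (induction n)
  case (Suc n)
  have "f (t + real (Suc n)) = f (t + real n + 1)" by (simp add: algebra_simps)
  then show ?case using Suc assms by (simp add: loop_def)
qed simp

text \<open>A monotone periodic function is constant: shifting by enough periods compares any two
  times in both orders.\<close>

lemma loop_left_derivative_zero:
  fixes f :: "real \<Rightarrow> real"
  assumes "loop f" and cont: "continuous_on UNIV f"
    and der: "\<And>t. (f has_vector_derivative D t) (at_left t)" and D: "\<And>t. D t \<le> 0"
  shows "D t = 0"
proof -
  have mono: "f b \<le> f a" if "a \<le> b" for a b
    by (rule left_derivative_nonpos_imp_nonincreasing[OF cont that]) (use der D in blast)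
  have "f a = f t" for a
  proof -
    obtain n where "t - a \<le> real n" using real_arch_simple by blast
    then have "f a \<le> f t" using mono[of t "a + real n"] loop_add_nat[OF assms(1), of a n] by simp
    moreover obtain n where "a - t \<le> real n" using real_arch_simple by blast
    then have "f t \<le> f a" using mono[of a "t + real n"] loop_add_nat[OF assms(1), of t n] by simp
    ultimately show ?thesis by simp
  qed
  then have "f = (\<lambda>_. f t)" by blast
  then have "(f has_vector_derivative 0) (at_left t)" by (metis has_vector_derivative_const)
  then show ?thesis using der[of t] trivial_limit_at_left_real vector_derivative_unique_within by blast
qed



text \<open>Free flight, bounces and corners obey one formula with non-negative coefficients, where
  \<open>\<alpha> > 0\<close> forces a unit momentum and \<open>\<beta> > 0\<close> forces contact
  with the boundary. Both may be positive, so gliding is covered as well.\<close>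

lemma (in billiard_table) closed_trajectory_left_derivative:
  assumes tr: "closed_billiard_trajectory K \<gamma>"
  shows "\<exists>\<alpha> \<beta>. 0 \<le> \<alpha> \<and> 0 \<le> \<beta> \<and> (\<alpha>, \<beta>) \<noteq> (0, 0) \<and> (\<alpha> > 0 \<longrightarrow> norm (snd (\<gamma> t)) = 1) \<and>
    (\<beta> > 0 \<longrightarrow> fst (\<gamma> t) \<in> frontier K) \<and>
    (\<gamma> has_vector_derivative (- \<alpha> *\<^sub>R snd (\<gamma> t), \<beta> *\<^sub>R g (fst (\<gamma> t)))) (at_left t)"
proof -
  define q p where "q = fst (\<gamma> t)" and "p = snd (\<gamma> t)"
  have \<gamma>: "\<gamma> t = (q, p)" by (simp add: q_def p_def)
  have B: "frontier (cball 0 1 :: 'a set) = {p. norm p = 1}" by (auto simp: sphere_def dist_norm)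
  have "\<gamma> t \<in> frontier (K \<times> cball 0 1)" using tr by (auto simp: closed_billiard_trajectory_def)
  then have qp: "q \<in> K" "norm p \<le> 1" "\<not> (q \<in> interior K \<and> norm p < 1)"
    using closed by (auto simp: \<gamma> frontier_def interior_Times closure_Times)
  obtain d where d: "d > 0"
    and eq: "\<And>t. \<gamma> t \<notin> frontier K \<times> frontier (cball 0 1) \<longrightarrow>
        (\<gamma> t \<in> interior K \<times> frontier (cball 0 1) \<longrightarrow>
           (\<gamma> has_vector_derivative d *\<^sub>R (- grad norm (snd (\<gamma> t)), 0)) (at t)) \<and>
        (\<gamma> t \<in> frontier K \<times> interior (cball 0 1) \<longrightarrow>
           (\<gamma> has_vector_derivative d *\<^sub>R (0, g (fst (\<gamma> t)))) (at t))"
    using tr unfolding closed_billiard_trajectory_def by blast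
  have int: "q \<in> interior K \<Longrightarrow> norm p = 1 \<Longrightarrow> q \<notin> frontier K \<Longrightarrow> (\<gamma> has_vector_derivative d *\<^sub>R (- grad norm p, 0)) (at t)"
    and bd: "q \<in> frontier K \<Longrightarrow> norm p < 1 \<Longrightarrow> (\<gamma> has_vector_derivative d *\<^sub>R (0, g q)) (at t)"
    using eq[of t] unfolding B by (auto simp: \<gamma>)
  have corner: "q \<in> frontier K \<Longrightarrow> norm p = 1 \<Longrightarrow> \<exists>D\<in>billiard_cone K (\<gamma> t). (\<gamma> has_vector_derivative D) (at_left t)"
  proof -
    assume "q \<in> frontier K" "norm p = 1"
    then have "\<gamma> t \<in> frontier K \<times> frontier (cball 0 1)" unfolding B by (simp add: \<gamma>)
    then show ?thesis
      using tr[unfolded closed_billiard_trajectory_def, THEN conjunct2, THEN conjunct2, THEN conjunct2,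
          THEN conjunct2, THEN spec[of _ t]] by simp
  qed
  consider "q \<in> interior K" "norm p = 1" "q \<notin> frontier K" | "q \<in> frontier K" "norm p < 1" | "q \<in> frontier K" "norm p = 1"
    using qp closed by (fastforce simp: frontier_def)
  then show ?thesis
  proof cases
    case 1
    have "(\<gamma> has_vector_derivative (- d *\<^sub>R p, 0 *\<^sub>R g q)) (at_left t)"
      using int[OF 1] grad_norm_unit[OF 1(2)] has_vector_derivative_at_within by force
    then show ?thesis using d 1 by (intro exI[of _ d] exI[of _ 0]) (simp add: \<gamma>)
  next
    case 2
    have "(\<gamma> has_vector_derivative (- 0 *\<^sub>R p, d *\<^sub>R g q)) (at_left t)"
      using bd[OF 2] has_vector_derivative_at_within by force
    then show ?thesis using d 2 by (intro exI[of _ 0] exI[of _ d]) (simp add: \<gamma>)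
  next
    case 3
    then obtain \<alpha> \<beta> where "0 \<le> \<alpha>" "0 \<le> \<beta>" "(\<alpha>, \<beta>) \<noteq> (0, 0)"
      "(\<gamma> has_vector_derivative \<alpha> *\<^sub>R (- grad norm p, 0) + \<beta> *\<^sub>R (0, g q)) (at_left t)"
      using corner[OF 3] unfolding billiard_cone_def by (auto simp: \<gamma>)
    then show ?thesis using 3 grad_norm_unit[OF 3(2)] by (intro exI[of _ \<alpha>] exI[of _ \<beta>]) (simp add: \<gamma>)
  qed
qed

text \<open>If \<open>q + v\<close> stays inside \<open>K\<close>, then \<open>p \<bullet> v\<close> decreases whenever \<open>p\<close> moves; by periodicity \<open>p\<close> never
  moves, and then \<open>q\<close> drifts forever in the direction \<open>- p\<close>.\<close>
lemma (in billiard_table) closed_trajectory_not_fits_inside: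
  assumes tr: "closed_billiard_trajectory K \<gamma>"
  shows "\<not> fits_inside (range (\<lambda>t. fst (\<gamma> t))) K"
proof
  assume "fits_inside (range (\<lambda>t. fst (\<gamma> t))) K"
  then obtain v where v: "\<And>t. fst (\<gamma> t) + v \<in> interior K" by (auto simp: fits_inside_def)
  obtain \<alpha> \<beta> where ab: "\<And>t. 0 \<le> \<alpha> t" "\<And>t. 0 \<le> \<beta> t" "\<And>t. (\<alpha> t, \<beta> t) \<noteq> (0, 0)"
    "\<And>t. \<alpha> t > 0 \<Longrightarrow> norm (snd (\<gamma> t)) = 1" "\<And>t. \<beta> t > 0 \<Longrightarrow> fst (\<gamma> t) \<in> frontier K"
    and der: "\<And>t. (\<gamma> has_vector_derivative (- \<alpha> t *\<^sub>R snd (\<gamma> t), \<beta> t *\<^sub>R g (fst (\<gamma> t)))) (at_left t)"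
    using closed_trajectory_left_derivative[OF tr] by metis
  have lp: "loop \<gamma>" and cont: "continuous_on UNIV \<gamma>"
    using tr by (auto simp: closed_billiard_trajectory_def piecewise_smooth_def)
  have dq: "((\<lambda>t. fst (\<gamma> t) \<bullet> u) has_vector_derivative - \<alpha> t *\<^sub>R snd (\<gamma> t) \<bullet> u) (at_left t)" for u t
    using bounded_linear.has_vector_derivative[OF bounded_linear_compose[OF bounded_linear_inner_left bounded_linear_fst] der] by simp
  have dp: "((\<lambda>t. snd (\<gamma> t) \<bullet> u) has_vector_derivative \<beta> t *\<^sub>R g (fst (\<gamma> t)) \<bullet> u) (at_left t)" for u t
    using bounded_linear.has_vector_derivative[OF bounded_linear_compose[OF bounded_linear_inner_left bounded_linear_snd] der] by simp
  \<comment> \<open>On the boundary \<open>g \<bullet> q = 1\<close>, while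
    \<open>g \<bullet> (q + v) < 1\<close> because \<open>q + v\<close> is interior; the difference
    is \<open>g \<bullet> v\<close>.\<close>
  have neg: "g (fst (\<gamma> t)) \<bullet> v < 0" if "fst (\<gamma> t) \<in> frontier K" for t
    using grad_gauge(1)[OF that] grad_gauge(2)[OF that v[of t]] by (simp add: inner_add_right)
  have lps: "loop (\<lambda>t. snd (\<gamma> t) \<bullet> u)" and lpf: "loop (\<lambda>t. fst (\<gamma> t) \<bullet> u)" for u using lp by (auto simp: loop_def)
  have cs: "continuous_on UNIV (\<lambda>t. snd (\<gamma> t) \<bullet> u)" and cf: "continuous_on UNIV (\<lambda>t. fst (\<gamma> t) \<bullet> u)" for u
    using cont by (auto intro!: continuous_intros)
  have nonpos: "\<beta> t *\<^sub>R g (fst (\<gamma> t)) \<bullet> v \<le> 0" for t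
    using ab(2,5)[of t] neg[of t] by (cases "\<beta> t = 0") (auto intro!: mult_nonneg_nonpos)
  have "\<beta> t *\<^sub>R g (fst (\<gamma> t)) \<bullet> v = 0" for t
    by (rule loop_left_derivative_zero[OF lps cs dp nonpos])
  then have b0: "\<beta> t = 0" for t using ab(2,5)[of t] neg[of t] by force
  then have a0: "\<alpha> t > 0" for t using ab(1,3)[of t] by (simp add: order_less_le)
  \<comment> \<open>Each component of the momentum now has left derivative zero. Shifting
    \<open>a\<close> past \<open>b\<close> by whole periods removes any condition on their order, so
    the inequality also holds with \<open>a\<close> and \<open>b\<close> exchanged.\<close>
  have const: "snd (\<gamma> a) \<bullet> u \<le> snd (\<gamma> b) \<bullet> u" for a b u
  proof -
    obtain n where n: "b - a \<le> real n" using real_arch_simple by blast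
    have "snd (\<gamma> (a + real n)) \<bullet> u \<le> snd (\<gamma> b) \<bullet> u"
    proof (rule left_derivative_nonpos_imp_nonincreasing[OF cs])
      show "\<exists>D\<le>0. ((\<lambda>t. snd (\<gamma> t) \<bullet> u) has_vector_derivative D) (at_left t)" for t
        using dp[of u t] b0[of t] by auto
    qed (use n in simp)
    then show ?thesis using loop_add_nat[OF lps[of u], of a n] by simp
  qed
  have "snd (\<gamma> t) \<bullet> u = snd (\<gamma> 0) \<bullet> u" for t u using const[of t u 0] const[of 0 u t] by simp
  then have p: "snd (\<gamma> t) = snd (\<gamma> 0)" for t by (metis inner_eq_zero_iff inner_diff_left right_minus_eq)
  \<comment> \<open>Testing \<open>q\<close> against the constant unit momentum gives the derivative
    \<open>- \<alpha> t\<close>, which is negative at all times.\<close>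
  have "fst (\<gamma> 1) \<bullet> snd (\<gamma> 0) < fst (\<gamma> 0) \<bullet> snd (\<gamma> 0)"
  proof (rule left_derivative_neg_imp_decreasing[OF cf])
    fix t
    have "norm (snd (\<gamma> 0)) = 1" using ab(4)[OF a0] by blast
    then have "- \<alpha> t *\<^sub>R snd (\<gamma> t) \<bullet> snd (\<gamma> 0) < 0" using a0[of t] unfolding p[of t] by (simp add: dot_square_norm)
    then show "\<exists>D<0. ((\<lambda>t. fst (\<gamma> t) \<bullet> snd (\<gamma> 0)) has_vector_derivative D) (at_left t)" using dq by blast
  qed simp
  moreover have "\<gamma> 1 = \<gamma> 0" using lp[unfolded loop_def, rule_format, of 0] by simp
  ultimately show False by simp
qed

section \<open>Shortest polygons that cannot be translated into the interior\<close>

text \<open>Only the values of \<open>P\<close> below \<open>N\<close> matter. Total functions keep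
  polygons of all sizes in one type.\<close>

definition cycle_length :: "nat \<Rightarrow> (nat \<Rightarrow> 'a::metric_space) \<Rightarrow> real" where
  "cycle_length N P = (\<Sum>i<N. dist (P i) (P (Suc i mod N)))"

lemma cycle_length_Suc:
  "cycle_length (Suc n) P = (\<Sum>i<n. dist (P i) (P (Suc i))) + dist (P n) (P 0)"
  by (simp add: cycle_length_def)

lemma cycle_length_nonneg: "0 \<le> cycle_length N P"
  by (simp add: cycle_length_def sum_nonneg)

lemma cycle_length_scaleR:
  fixes P :: "nat \<Rightarrow> 'a::real_normed_vector"
  shows "cycle_length N (\<lambda>i. s *\<^sub>R P i) = \<bar>s\<bar> * cycle_length N P"
  by (simp add: cycle_length_def dist_norm sum_distrib_left flip: scaleR_diff_right)

lemma dist_le_sum: "dist (P 0) (P i) \<le> (\<Sum>j<i. dist (P j) (P (Suc j)))"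
proof (induction i)
  case (Suc i)
  have "dist (P 0) (P (Suc i)) \<le> dist (P 0) (P i) + dist (P i) (P (Suc i))" by (rule dist_triangle)
  then show ?case using Suc by simp
qed simp

lemma dist_le_cycle_length:
  assumes "i < N"
  shows "dist (P 0) (P i) \<le> cycle_length N P"
proof -
  have "dist (P 0) (P i) \<le> (\<Sum>j<i. dist (P j) (P (Suc j)))" by (rule dist_le_sum)
  also have "\<dots> = (\<Sum>j<i. dist (P j) (P (Suc j mod N)))" using assms by (intro sum.cong) auto
  also have "\<dots> \<le> cycle_length N P" unfolding cycle_length_def using assms by (intro sum_mono2) auto
  finally show ?thesis .
qed

lemma sum_rotate:
  fixes f :: "nat \<Rightarrow> real"
  shows "(\<Sum>i<N. f ((i + c) mod N)) = (\<Sum>i<N. f i)"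
proof (induction c)
  case 0
  show ?case by (intro sum.cong) auto
next
  case (Suc c)
  \<comment> \<open>The sum over \<open>Suc N\<close> terms is split at either end; the first term
    \<open>f (c mod N)\<close> and the last term \<open>f ((N + c) mod N)\<close> agree.\<close>
  have "(\<Sum>i<Suc N. f ((i + c) mod N)) = f (c mod N) + (\<Sum>i<N. f ((i + Suc c) mod N))"
    by (subst sum.lessThan_Suc_shift) simp
  then show ?case using Suc by simp
qed

lemma cycle_length_rotate: "cycle_length N (\<lambda>i. P ((i + c) mod N)) = cycle_length N P"
proof -
  have "cycle_length N (\<lambda>i. P ((i + c) mod N)) = (\<Sum>i<N. dist (P ((i + c) mod N)) (P (Suc ((i + c) mod N) mod N)))"
    unfolding cycle_length_def by (intro sum.cong) (auto simp: mod_simps)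
  also have "\<dots> = cycle_length N P"
    unfolding cycle_length_def by (rule sum_rotate[of "\<lambda>i. dist (P i) (P (Suc i mod N))"])
  finally show ?thesis .
qed

text \<open>After a rotation the vertex to be removed comes last, and cutting it off is one triangle
  inequality.\<close>

lemma remove_vertex:
  assumes N: "N \<ge> 2" and k: "k < N"
  obtains Q where "P ` ({..<N} - {k}) \<subseteq> Q ` {..<N - 1}" "cycle_length (N - 1) Q \<le> cycle_length N P"
proof
  define R where "R i = P ((i + Suc k) mod N)" for i
  obtain m where m: "N = Suc (Suc m)" using N by (metis add_2_eq_Suc le_Suc_ex)
  show "P ` ({..<N} - {k}) \<subseteq> R ` {..<N - 1}"
  proof
    fix x assume "x \<in> P ` ({..<N} - {k})"
    then obtain j where j: "j < N" "j \<noteq> k" "x = P j" by auto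
    define i where "i = (if k < j then j - Suc k else j + N - Suc k)"
    have "i < N - 1" "(i + Suc k) mod N = j" using j k N by (auto simp: i_def)
    then show "x \<in> R ` {..<N - 1}" using j by (auto simp: R_def)
  qed
  have "cycle_length (Suc m) R \<le> cycle_length N R"
    using dist_triangle[of "R m" "R 0" "R (Suc m)"] by (simp add: m cycle_length_Suc)
  also have "\<dots> = cycle_length N P" unfolding R_def by (rule cycle_length_rotate)
  finally show "cycle_length (N - 1) R \<le> cycle_length N P" by (simp add: m)
qed

text \<open>Moving the first vertex to the origin confines all competitors to a ball whose radius is
  the length of \<open>P0\<close>. With the coordinates from \<open>N\<close> on set to zero they
  lie in a product of balls, compact by Tychonoff's theorem, in which not fitting is a closed
  condition.\<close>

lemma shortest_cycle_fixed_number: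
  fixes K :: "'a::euclidean_space set"
  assumes "\<not> fits_inside (P0 ` {..<N}) K"
  shows "\<exists>P. \<not> fits_inside (P ` {..<N}) K \<and> (\<forall>P'. \<not> fits_inside (P' ` {..<N}) K \<longrightarrow> cycle_length N P \<le> cycle_length N P')"
proof -
  define l where "l = cycle_length N P0"
  define S where "S = PiE UNIV (\<lambda>_::nat. cball (0::'a) l) \<inter> {P. \<not> fits_inside (P ` {..<N}) K}"
  define M where "M P = (\<lambda>i. if i < N then P i - P 0 else 0)" for P :: "nat \<Rightarrow> 'a"
  have cM: "cycle_length N (M P) = cycle_length N P" for P
    unfolding cycle_length_def M_def by (intro sum.cong) (auto simp: dist_norm)
  have nM: "\<not> fits_inside (M P ` {..<N}) K" if "\<not> fits_inside (P ` {..<N}) K" for P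
  proof
    assume "fits_inside (M P ` {..<N}) K"
    then obtain v where v: "\<forall>i<N. P i - P 0 + v \<in> interior K" by (auto simp: fits_inside_def M_def)
    have "\<forall>i<N. P i + (v - P 0) \<in> interior K" using v by (simp add: algebra_simps)
    then show False using that by (auto simp: fits_inside_def)
  qed
  have bM: "norm (M P i) \<le> cycle_length N P" for P i
    using dist_le_cycle_length[of i N P] cycle_length_nonneg[of N P] by (auto simp: M_def dist_norm norm_minus_commute)
  have coord: "continuous_on A (\<lambda>P::nat \<Rightarrow> 'a. P i)" for A i
    by (rule continuous_on_subset[OF continuous_on_product_coordinates]) simp
  have "{P. \<not> fits_inside (P ` {..<N}) K} = (\<Inter>v. \<Union>i<N. (\<lambda>P. P i + v) -` (- interior K))"
    by (auto simp: fits_inside_def)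
  moreover have "closed (\<Inter>v. \<Union>i<N. (\<lambda>P::nat \<Rightarrow> 'a. P i + v) -` (- interior K))"
    by (intro closed_INT ballI closed_UN closed_vimage continuous_intros coord) auto
  moreover have "compact (PiE UNIV (\<lambda>_::nat. cball (0::'a) l))"
    unfolding compactin_euclidean_iff[symmetric] euclidean_product_topology[symmetric]
    by (simp add: compactin_PiE)
  ultimately have S: "compact S" unfolding S_def by (simp add: compact_Int_closed)
  have MS: "M P \<in> S" if "\<not> fits_inside (P ` {..<N}) K" "cycle_length N P \<le> l" for P
    using order_trans[OF bM[of P] that(2)] nM[OF that(1)] by (auto simp: S_def)
  have "M P0 \<in> S" using MS assms by (simp add: l_def)
  moreover have "continuous_on S (cycle_length N)"
    unfolding cycle_length_def by (intro continuous_intros coord)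
  ultimately obtain P where P: "P \<in> S" "\<And>P'. P' \<in> S \<Longrightarrow> cycle_length N P \<le> cycle_length N P'"
    using continuous_attains_inf[OF S] by blast
  have "cycle_length N P \<le> cycle_length N P'" if "\<not> fits_inside (P' ` {..<N}) K" for P'
    using P(2)[of "M P'"] P(2)[OF \<open>M P0 \<in> S\<close>] MS[OF that] cM[of P'] cM[of P0] by (fastforce simp: l_def)
  then show ?thesis using P(1) unfolding S_def by blast
qed

text \<open>The tie-break by the number of vertices excludes repeated vertices and vertices inside an edge.\<close>
definition shortest_cycle :: "'a::euclidean_space set \<Rightarrow> nat \<Rightarrow> (nat \<Rightarrow> 'a) \<Rightarrow> bool" where
  "shortest_cycle K N P \<longleftrightarrow> N \<le> DIM('a) + 1 \<and> \<not> fits_inside (P ` {..<N}) K \<and>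
     (\<forall>N' P'. N' \<le> DIM('a) + 1 \<and> \<not> fits_inside (P' ` {..<N'}) K \<longrightarrow>
        cycle_length N P \<le> cycle_length N' P' \<and> (N' < N \<longrightarrow> cycle_length N P < cycle_length N' P'))"

lemma shortest_cycle_exists:
  fixes K :: "'a::euclidean_space set"
  assumes K: "bounded K"
  shows "\<exists>N P. shortest_cycle K N P"
proof -
  define S where "S = {N. N \<le> DIM('a) + 1 \<and> (\<exists>P. \<not> fits_inside (P ` {..<N}) K)}"
  define D where "D N P \<longleftrightarrow> \<not> fits_inside (P ` {..<N}) K \<and> (\<forall>P'. \<not> fits_inside (P' ` {..<N}) K \<longrightarrow> cycle_length N P \<le> cycle_length N P')" for N P
  have "\<exists>P. D N P" if "N \<in> S" for N
    using shortest_cycle_fixed_number that unfolding S_def D_def by blast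
  then obtain p where p: "\<And>N. N \<in> S \<Longrightarrow> D N (p N)" by metis
  define m where "m N = cycle_length N (p N)" for N
  obtain r where r: "r > 0" "K \<subseteq> ball 0 r" using K bounded_subset_ballD by blast
  obtain e :: 'a where e: "e \<in> Basis" using nonempty_Basis by blast
  \<comment> \<open>\<open>K\<close> lies in an open ball of radius \<open>r\<close>, which contains
    no two points at distance \<open>2 * r\<close>; this digon therefore does not fit.\<close>
  define P where "P i = (if i = 0 then 0 else (2 * r) *\<^sub>R e)" for i :: nat
  have "\<not> fits_inside (P ` {..<2}) K"
  proof
    assume "fits_inside (P ` {..<2}) K"
    then obtain v where v: "\<And>i. i < 2 \<Longrightarrow> P i + v \<in> interior K" by (auto simp: fits_inside_def)
    have "norm v < r" "norm ((2 * r) *\<^sub>R e + v) < r"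
      using v[of 0] v[of 1] r interior_subset[of K] by (auto simp: P_def)
    moreover have "norm ((2 * r) *\<^sub>R e) = 2 * r" using e r by simp
    ultimately show False using norm_triangle_ineq4[of "(2 * r) *\<^sub>R e + v" v] by simp
  qed
  moreover have "DIM('a) \<ge> 1" by (simp add: Suc_leI)
  ultimately have "2 \<in> S" by (auto simp: S_def)
  moreover have fS: "finite S" unfolding S_def by (rule finite_subset[of _ "{..DIM('a) + 1}"]) auto
  ultimately have "Min (m ` S) \<in> m ` S" by (intro Min_in) auto
  then have ex: "\<exists>N. N \<in> S \<and> m N = Min (m ` S)" by auto
  \<comment> \<open>The least size attaining the overall minimum yields the strict inequality for
    smaller sizes.\<close>
  define N where "N = (LEAST N. N \<in> S \<and> m N = Min (m ` S))"
  have N: "N \<in> S" "m N = Min (m ` S)" using LeastI_ex[OF ex] by (auto simp: N_def)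
  have "shortest_cycle K N (p N)"
    unfolding shortest_cycle_def
  proof (intro conjI allI impI)
    show "N \<le> DIM('a) + 1" "\<not> fits_inside (p N ` {..<N}) K"
      using N p[of N] by (auto simp: S_def D_def)
    fix N' and P' :: "nat \<Rightarrow> 'a" assume *: "N' \<le> DIM('a) + 1 \<and> \<not> fits_inside (P' ` {..<N'}) K"
    then have N': "N' \<in> S" by (auto simp: S_def)
    then have le: "m N' \<le> cycle_length N' P'" using p[OF N'] * by (auto simp: D_def m_def)
    moreover have ge: "m N \<le> m N'" using N fS N' by simp
    ultimately show "cycle_length N (p N) \<le> cycle_length N' P'" by (simp add: m_def)
    assume "N' < N"
    then have "m N' \<noteq> m N"
      using not_less_Least[of N' "\<lambda>N. N \<in> S \<and> m N = Min (m ` S)"] N' N(2) by (simp add: N_def)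
    then show "cycle_length N (p N) < cycle_length N' P'" using le ge by (simp add: m_def)
  qed
  then show ?thesis by blast
qed

text \<open>Adding the parameters 0 and 1 makes the inscribed polygon pass through the common value
  \<open>q 0 = q 1\<close>; the triangle inequality at that point replaces the detour by the closing
  edge.\<close>

lemma inscribed_cycle_le_loop_length:
  fixes q :: "real \<Rightarrow> 'a::metric_space"
  assumes "q 0 = q 1" "sorted ts" "set ts \<subseteq> {0..1}"
  shows "ennreal (cycle_length (length ts) (\<lambda>i. q (ts ! i))) \<le> loop_length q"
proof (cases "length ts")
  case (Suc n)
  define ts' where "ts' = 0 # ts @ [1]"
  have "ts' \<in> {ts. sorted ts \<and> set ts \<subseteq> {0..1}}" using assms by (auto simp: ts'_def sorted_append)
  then have le: "(\<Sum>i<length ts' - 1. ennreal (dist (q (ts' ! i)) (q (ts' ! Suc i)))) \<le> loop_length q"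
    unfolding loop_length_def by (intro SUP_upper)
  have "cycle_length (length ts) (\<lambda>i. q (ts ! i)) \<le> (\<Sum>i<length ts' - 1. dist (q (ts' ! i)) (q (ts' ! Suc i)))"
  proof -
    have "(\<Sum>i<length ts' - 1. dist (q (ts' ! i)) (q (ts' ! Suc i))) = (\<Sum>i<Suc (Suc n). dist (q (ts' ! i)) (q (ts' ! Suc i)))"
      using Suc by (simp add: ts'_def)
    also have "\<dots> = dist (q 0) (q (ts ! 0)) + (\<Sum>i<Suc n. dist (q (ts ! i)) (q ((ts @ [1]) ! Suc i)))"
      using Suc by (subst sum.lessThan_Suc_shift) (auto simp: ts'_def nth_append intro!: sum.cong)
    also have "\<dots> = dist (q 0) (q (ts ! 0)) + ((\<Sum>i<n. dist (q (ts ! i)) (q (ts ! Suc i))) + dist (q (ts ! n)) (q 1))"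
      using Suc by (auto simp: nth_append)
    finally show ?thesis
      using dist_triangle[of "q (ts ! n)" "q (ts ! 0)" "q 1"] assms(1) by (simp add: Suc cycle_length_Suc)
  qed
  then show ?thesis using le by (simp add: sum_ennreal) (meson ennreal_leI order_trans)
qed (simp add: cycle_length_def)

section \<open>From inscribed polygons to loops by Helly's theorem\<close>

context billiard_table
begin

text \<open>The translations carrying \<open>q t\<close> into the scaled body form a compact convex
  set \<open>A t\<close>. Helly's theorem gives a common translation for finitely many
  \<open>t\<close>, and compactness extends it to all of \<open>T\<close>.\<close>

lemma Helly_translates:
  fixes q :: "'b \<Rightarrow> 'a"
  assumes cK: "0 \<le> c" and T: "T \<noteq> {}"
    and small: "\<And>U. U \<subseteq> T \<Longrightarrow> finite U \<Longrightarrow> card U \<le> DIM('a) + 1 \<Longrightarrow> \<exists>v. \<forall>t\<in>U. q t + v \<in> (\<lambda>x. c *\<^sub>R x) ` K"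
  shows "\<exists>v. \<forall>t\<in>T. q t + v \<in> (\<lambda>x. c *\<^sub>R x) ` K"
proof -
  define A where "A t = (+) (- q t) ` ((\<lambda>x. c *\<^sub>R x) ` K)" for t
  have A: "v \<in> A t \<longleftrightarrow> q t + v \<in> (\<lambda>x. c *\<^sub>R x) ` K" for v t
  proof -
    have "v \<in> (+) (- q t) ` X \<longleftrightarrow> q t + v \<in> X" for X
      by (metis add_minus_cancel image_iff minus_add_cancel)
    then show ?thesis by (simp add: A_def)
  qed
  have cA: "compact (A t)" "convex (A t)" for t
    unfolding A_def by (intro compact_translation compact_scaling compact convex_translation convex_scaling convex)+
  have small': "\<Inter>F \<noteq> {}" if F: "F \<subseteq> A ` T" "finite F" "card F \<le> DIM('a) + 1" for F
  proof -
    \<comment> \<open>\<open>A\<close> need not be injective: picking one parameter for each member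
      of \<open>F\<close> carries the bound on \<open>card F\<close> over to the parameters.\<close>
    obtain U where U: "U \<subseteq> T" "inj_on A U" "F = A ` U" using F(1) subset_image_inj[of F A T] by auto
    have "finite U" "card U \<le> DIM('a) + 1" using F U by (auto simp: finite_image_iff card_image)
    then obtain v where "\<forall>t\<in>U. v \<in> A t" using small[OF U(1)] A by blast
    then show ?thesis using U(3) by blast
  qed
  have fin: "\<Inter>F \<noteq> {}" if F: "F \<subseteq> A ` T" "finite F" for F
  proof (cases "card F \<le> DIM('a) + 1")
    case False
    show ?thesis
    proof (rule Helly)
      show "\<Inter>t \<noteq> {}" if "t \<subseteq> F" "card t = DIM('a) + 1" for t
        using small'[of t] that F finite_subset by fastforce
    qed (use False F cA in auto)
  qed (use small' F in blast)
  obtain t0 where t0: "t0 \<in> T" using T by blast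
  have "A t0 \<inter> \<Inter>(A ` T) \<noteq> {}"
  proof (rule compact_imp_fip[OF cA(1)])
    show "closed X" if "X \<in> A ` T" for X using that cA(1) compact_imp_closed by blast
    show "A t0 \<inter> \<Inter>F \<noteq> {}" if "finite F" "F \<subseteq> A ` T" for F
      using fin[of "insert (A t0) F"] that t0 by simp
  qed
  then show ?thesis using A by blast
qed

text \<open>A loop shorter than the shortest cycle stays shorter after a slight enlargement, so its inscribed
  \<open>n + 1\<close>-gons fit inside a slightly smaller copy of \<open>K\<close>; by Helly so does the loop.\<close>
lemma shortest_cycle_le_loop_length:
  assumes min: "shortest_cycle K N P" and q: "q 0 = q 1" and nf: "\<not> fits_inside (q ` {0..1}) K"
  shows "ennreal (cycle_length N P) \<le> loop_length q"
proof (rule ccontr)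
  define m where "m = cycle_length N P"
  assume "\<not> ennreal (cycle_length N P) \<le> loop_length q"
  then have lt: "loop_length q < ennreal m" by (simp add: m_def)
  then obtain l where l: "0 \<le> l" "loop_length q = ennreal l"
    by (cases "loop_length q") auto
  then have lm: "l < m" using lt by (simp add: ennreal_less_iff)
  \<comment> \<open>\<open>m / s\<close> is the mean of \<open>m\<close> and \<open>l\<close>, hence
    lies strictly between them.\<close>
  define s where "s = 2 * m / (m + l)"
  have s: "s > 1" "s * l < m"
  proof -
    show "s > 1" using l lm by (simp add: s_def)
    have "m * (2 * l) < m * (m + l)" using l lm by (intro mult_strict_left_mono) auto
    then show "s * l < m" using l lm by (simp add: s_def divide_simps algebra_simps)
  qed
  have "\<exists>v. \<forall>t\<in>U. q t + v \<in> (\<lambda>x. (1 / s) *\<^sub>R x) ` K"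
    if U: "U \<subseteq> {0..1}" "finite U" "card U \<le> DIM('a) + 1" for U
  proof -
    \<comment> \<open>Sorting orders the vertices along the loop, so that the polygon is inscribed
      in it.\<close>
    define ts where "ts = sorted_list_of_set U"
    have ts: "sorted ts" "set ts = U" "length ts = card U" using U by (auto simp: ts_def)
    define R where "R i = s *\<^sub>R q (ts ! i)" for i
    have "ennreal (cycle_length (length ts) (\<lambda>i. q (ts ! i))) \<le> ennreal l"
      using inscribed_cycle_le_loop_length[OF q ts(1)] ts(2) U(1) l(2) by simp
    then have "cycle_length (length ts) (\<lambda>i. q (ts ! i)) \<le> l" using l(1) by simp
    then have "s * cycle_length (length ts) (\<lambda>i. q (ts ! i)) \<le> s * l" using s by (intro mult_left_mono) auto
    moreover have "cycle_length (length ts) R = s * cycle_length (length ts) (\<lambda>i. q (ts ! i))"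
      using s unfolding R_def cycle_length_scaleR by simp
    ultimately have "cycle_length (length ts) R < m" using s(2) by linarith
    then have "fits_inside (R ` {..<length ts}) K"
      using min ts(3) U(3) unfolding shortest_cycle_def m_def by (metis not_le)
    then obtain v where v: "\<forall>i<length ts. R i + v \<in> interior K" by (auto simp: fits_inside_def)
    have "q t + (1 / s) *\<^sub>R v \<in> (\<lambda>x. (1 / s) *\<^sub>R x) ` K" if t: "t \<in> U" for t
    proof -
      obtain i where i: "i < length ts" "t = ts ! i" using t ts(2) by (metis in_set_conv_nth)
      show ?thesis
      proof (rule image_eqI)
      show "R i + v \<in> K" using v i interior_subset by blast
      show "q t + (1 / s) *\<^sub>R v = (1 / s) *\<^sub>R (R i + v)" using s i by (simp add: R_def scaleR_add_right)
      qed
    qed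
    then show ?thesis by blast
  qed
  then obtain v where v: "\<forall>t\<in>{0..1}. q t + v \<in> (\<lambda>x. (1 / s) *\<^sub>R x) ` K"
    using Helly_translates[of "1 / s" "{0..1::real}" q] s by auto
  \<comment> \<open>Helly's theorem needs compact sets and so yields only containment in the closed
    body scaled by \<open>1 / s\<close>; as the origin is interior and \<open>s > 1\<close>, this
    copy lies in the interior of \<open>K\<close>.\<close>
  have "(1 / s) *\<^sub>R x \<in> interior K" if "x \<in> K" for x
    using mem_interior_convex_shrink[OF convex zero that, of "1 - 1 / s"] s by (simp add: algebra_simps)
  then have "(\<lambda>x. (1 / s) *\<^sub>R x) ` K \<subseteq> interior K" by blast
  then have "\<forall>x\<in>q ` {0..1}. x + v \<in> interior K" using v by fast
  then have "fits_inside (q ` {0..1}) K" unfolding fits_inside_def by blast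
  then show False using nf by blast
qed

end

section \<open>Reflection law for shortest polygons\<close>

lemma finite_uniform_threshold:
  fixes Q :: "nat \<Rightarrow> real \<Rightarrow> bool"
  assumes "\<And>i. i < N \<Longrightarrow> \<exists>\<tau>>0. \<forall>t. 0 < t \<and> t < \<tau> \<longrightarrow> Q i t"
  shows "\<exists>t>0. \<forall>i<N. Q i t"
proof -
  have "eventually (Q i) (at_right 0)" if "i < N" for i
    using assms[OF that] by (auto simp: eventually_at_right_field)
  then have "eventually (\<lambda>t. \<forall>i\<in>{..<N}. Q i t) (at_right 0)" by (intro eventually_ball_finite) auto
  then have "eventually (\<lambda>t. t > 0 \<and> (\<forall>i\<in>{..<N}. Q i t)) (at_right 0)"
    by (intro eventually_conj eventually_at_right_less)
  then show ?thesis using eventually_happens trivial_limit_at_right_real by fast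
qed

lemma norm_line_derivative:
  fixes x y :: "'a::real_inner"
  assumes "x \<noteq> 0"
  shows "((\<lambda>t. norm (x + t *\<^sub>R y)) has_real_derivative sgn x \<bullet> y) (at 0)"
proof -
  have "((\<lambda>t. x + t *\<^sub>R y) has_derivative (\<lambda>h. h *\<^sub>R y)) (at 0)" by (auto intro!: derivative_eq_intros)
  moreover have "(norm has_derivative (\<lambda>h. h \<bullet> sgn x)) (at (x + 0 *\<^sub>R y))"
    using has_derivative_norm[OF assms] by simp
  ultimately have "((\<lambda>t. norm (x + t *\<^sub>R y)) has_derivative (\<lambda>h. (h *\<^sub>R y) \<bullet> sgn x)) (at 0)"
    by (rule has_derivative_compose)
  moreover have "(\<lambda>h. (h *\<^sub>R y) \<bullet> sgn x) = (*) (sgn x \<bullet> y)" by (auto simp: inner_commute)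
  ultimately show ?thesis by (simp add: has_field_derivative_def)
qed

context billiard_table
begin

text \<open>Otherwise a hyperplane strictly separates the origin from the contact gradients. Moving
  against its normal \<open>a\<close> pushes every contact point inward, and for a short time the
  remaining vertices stay interior, so the polygon would fit.\<close>

lemma zero_in_hull_contact_gradients:
  fixes Q :: "nat \<Rightarrow> 'a"
  assumes QK: "\<And>i. i < N \<Longrightarrow> Q i \<in> K" and nf: "\<not> fits_inside (Q ` {..<N}) K"
  shows "0 \<in> convex hull ((\<lambda>i. g (Q i)) ` {i. i < N \<and> Q i \<in> frontier K})" (is "0 \<in> convex hull ?X")
proof (rule ccontr)
  assume "0 \<notin> convex hull ?X"
  moreover have "finite ?X" by simp
  then have "closed (convex hull ?X)" by (intro compact_imp_closed finite_imp_compact_convex_hull)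
  ultimately obtain a b where ab: "0 < b" "\<forall>x\<in>convex hull ?X. a \<bullet> x > b"
    using separating_hyperplane_closed_0[OF convex_convex_hull] by meson
  have "\<exists>\<tau>>0. \<forall>t. 0 < t \<and> t < \<tau> \<longrightarrow> Q i + t *\<^sub>R (- a) \<in> interior K" if i: "i < N" for i
  proof (cases "Q i \<in> frontier K")
    case True
    have "g (Q i) \<in> convex hull ?X" using True i by (intro hull_inc) auto
    then have "g (Q i) \<bullet> (- a) < 0" using ab by (auto simp: inner_commute)
    then show ?thesis by (rule grad_gauge(3)[OF True])
  next
    case False
    then have "Q i \<in> interior K" using QK[OF i] closure_subset by (auto simp: frontier_def)
    then obtain e where e: "e > 0" "ball (Q i) e \<subseteq> interior K" using open_interior open_contains_ball by blast
    show ?thesis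
    proof (intro exI[of _ "e / (norm a + 1)"] conjI allI impI)
      have n: "norm a + 1 > 0" using norm_ge_zero[of a] by linarith
      then show "e / (norm a + 1) > 0" using e by simp
      fix t assume t: "0 < t \<and> t < e / (norm a + 1)"
      have "t * norm a \<le> t * (norm a + 1)" using t by (intro mult_left_mono) auto
      also have "\<dots> < e" using t n by (simp add: pos_less_divide_eq)
      finally have "Q i + t *\<^sub>R (- a) \<in> ball (Q i) e" using t by (simp add: dist_norm)
      then show "Q i + t *\<^sub>R (- a) \<in> interior K" using e by blast
    qed
  qed
  then obtain t where "\<forall>i<N. Q i + t *\<^sub>R (- a) \<in> interior K"
    using finite_uniform_threshold[of N "\<lambda>i t. Q i + t *\<^sub>R (- a) \<in> interior K"] by blast
  then have "fits_inside (Q ` {..<N}) K" unfolding fits_inside_def by blast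
  then show False using nf by blast
qed

text \<open>The convex combination is indexed by gradients, but weights are wanted per vertex.
  Several contact vertices may share a gradient, so \<open>J\<close> selects one of them for each
  gradient and all other vertices get weight zero.\<close>

lemma contact_weights:
  assumes QK: "\<And>i. i < N \<Longrightarrow> Q i \<in> K" and nf: "\<not> fits_inside (Q ` {..<N}) K"
  obtains l :: "nat \<Rightarrow> real" where "\<And>i. l i \<ge> 0" "(\<Sum>i<N. l i) = 1" "(\<Sum>i<N. l i *\<^sub>R g (Q i)) = 0"
    "\<And>i. i < N \<Longrightarrow> l i \<noteq> 0 \<Longrightarrow> Q i \<in> frontier K"
proof -
  let ?G = "\<lambda>i. g (Q i)"
  let ?I = "{i. i < N \<and> Q i \<in> frontier K}"
  have "finite (?G ` ?I)" by simp
  then obtain u where u: "\<And>x. x \<in> ?G ` ?I \<Longrightarrow> 0 \<le> u x" "sum u (?G ` ?I) = 1" "(\<Sum>x\<in>?G ` ?I. u x *\<^sub>R x) = 0"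
    using zero_in_hull_contact_gradients[OF QK nf] unfolding convex_hull_finite[OF \<open>finite (?G ` ?I)\<close>] by blast
  obtain J where J: "J \<subseteq> ?I" "inj_on ?G J" "?G ` ?I = ?G ` J"
    using subset_image_inj[of "?G ` ?I" ?G ?I] by auto
  define l where "l i = (if i \<in> J then u (?G i) else 0)" for i
  have JN: "J \<subseteq> {..<N}" using J by auto
  have "(\<Sum>i<N. l i) = (\<Sum>i\<in>J. u (?G i))"
    using JN unfolding l_def by (simp add: sum.If_cases Int_absorb1)
  also have "\<dots> = 1" using u(2) J by (simp add: sum.reindex)
  finally have 1: "(\<Sum>i<N. l i) = 1" .
  have "(\<Sum>i<N. l i *\<^sub>R ?G i) = (\<Sum>i<N. if i \<in> J then u (?G i) *\<^sub>R ?G i else 0)"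
    unfolding l_def by (intro sum.cong) auto
  also have "\<dots> = (\<Sum>i\<in>J. u (?G i) *\<^sub>R ?G i)"
    using JN by (simp add: sum.If_cases Int_absorb1)
  also have "\<dots> = 0" using u(3) J by (simp add: sum.reindex)
  finally have 2: "(\<Sum>i<N. l i *\<^sub>R ?G i) = 0" .
  show thesis
    by (rule that[of l, OF _ 1 2]) (use u(1) J in \<open>auto simp: l_def split: if_splits\<close>)
qed

text \<open>Hence the shortest cycle minimises the length under a single linear constraint.\<close>
lemma weights_not_fits_inside:
  fixes P Q :: "nat \<Rightarrow> 'a"
  assumes l: "\<And>i. l i \<ge> 0" "(\<Sum>i<N. l i) = 1" "(\<Sum>i<N. l i *\<^sub>R g (Q i)) = 0"
    and fr: "\<And>i. i < N \<Longrightarrow> l i \<noteq> 0 \<Longrightarrow> Q i \<in> frontier K"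
    and P: "(\<Sum>i<N. l i * (g (Q i) \<bullet> P i)) \<ge> 1"
  shows "\<not> fits_inside (P ` {i. i < N \<and> l i \<noteq> 0}) K"
proof
  assume "fits_inside (P ` {i. i < N \<and> l i \<noteq> 0}) K"
  then obtain v where v: "\<And>i. i < N \<Longrightarrow> l i \<noteq> 0 \<Longrightarrow> P i + v \<in> interior K" by (auto simp: fits_inside_def)
  have lt: "l i * (g (Q i) \<bullet> (P i + v)) < l i" if "i < N" "l i \<noteq> 0" for i
    using grad_gauge(2)[OF fr[OF that] v[OF that]] l(1)[of i] that by (simp add: order_less_le)
  \<comment> \<open>Because the weighted gradients sum to zero, the translation \<open>v\<close>
    leaves this sum unchanged, and by assumption it was at least 1, the total weight. Interior
    points make it smaller than that.\<close>
  have "(\<Sum>i<N. l i * (g (Q i) \<bullet> (P i + v))) < (\<Sum>i<N. l i)"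
  proof (rule sum_strict_mono_ex1)
    show "\<forall>i\<in>{..<N}. l i * (g (Q i) \<bullet> (P i + v)) \<le> l i"
    proof
      fix i assume "i \<in> {..<N}"
      then show "l i * (g (Q i) \<bullet> (P i + v)) \<le> l i" using lt[of i] by (cases "l i = 0") auto
    qed
    obtain i where "i < N" "l i \<noteq> 0" using l(2) by (metis lessThan_iff sum.neutral zero_neq_one)
    then show "\<exists>i\<in>{..<N}. l i * (g (Q i) \<bullet> (P i + v)) < l i" using lt by auto
  qed simp
  moreover have "(\<Sum>i<N. l i * (g (Q i) \<bullet> (P i + v))) = (\<Sum>i<N. l i * (g (Q i) \<bullet> P i)) + (\<Sum>i<N. l i *\<^sub>R g (Q i)) \<bullet> v"
    by (simp add: inner_add_right distrib_left sum.distrib inner_sum_left)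
  ultimately show False using P l by simp
qed

lemma shortest_cycle_positive:
  assumes "shortest_cycle K N P"
  shows "cycle_length N P > 0" and "N \<ge> 2"
proof -
  have nf: "\<not> fits_inside (P ` {..<N}) K" using assms by (auto simp: shortest_cycle_def)
  have 1: "\<exists>i<N. P i \<noteq> P 0"
  proof (rule ccontr)
    assume "\<not> (\<exists>i<N. P i \<noteq> P 0)"
    then have "P i + (- P 0) = 0" if "i < N" for i using that by (metis add.right_inverse)
    then have "\<forall>x\<in>P ` {..<N}. x + (- P 0) \<in> interior K" using zero by (metis imageE lessThan_iff)
    then show False using nf unfolding fits_inside_def by blast
  qed
  then obtain i where i: "i < N" "P i \<noteq> P 0" by blast
  show "cycle_length N P > 0"   proof -
    have "0 < dist (P 0) (P i)" using i(2) by simp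
    then show ?thesis using dist_le_cycle_length[OF i(1), of P] by linarith
  qed
  have "i \<noteq> 0" using i by metis
  then show "N \<ge> 2" using i(1) by simp
qed

text \<open>Shrinking the cycle by a factor below 1 makes it shorter than minimal, so the shrunken
  cycle fits. As the factor tends to 1 the translations subconverge, because they keep the first
  vertex in the compact body; the limit lands in \<open>K\<close>, though no longer in its
  interior.\<close>

lemma shortest_cycle_translate:
  assumes min: "shortest_cycle K N P"
  obtains v where "\<And>i. i < N \<Longrightarrow> P i + v \<in> K"
proof -
  define s where "s k = 1 - 1 / real (k + 2)" for k :: nat
  have s: "0 \<le> s k" "s k < 1" for k by (auto simp: s_def)
  have "fits_inside ((\<lambda>i. s k *\<^sub>R P i) ` {..<N}) K" for k
  proof -
    have "s k * cycle_length N P < 1 * cycle_length N P"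
      using s shortest_cycle_positive[OF min] by (intro mult_strict_right_mono) auto
    then have "cycle_length N (\<lambda>i. s k *\<^sub>R P i) < cycle_length N P" using s by (simp add: cycle_length_scaleR)
    then show ?thesis using min unfolding shortest_cycle_def by (metis not_le)
  qed
  then have "\<forall>k. \<exists>v. \<forall>i<N. s k *\<^sub>R P i + v \<in> K" unfolding fits_inside_def using interior_subset by blast
  then obtain v where v: "\<And>k i. i < N \<Longrightarrow> s k *\<^sub>R P i + v k \<in> K" by metis
  have N: "0 < N" using shortest_cycle_positive[OF min] by simp
  have "\<forall>k. s k *\<^sub>R P 0 + v k \<in> K" using v N by blast
  then obtain x r where x: "x \<in> K" "strict_mono r" "((\<lambda>k. s k *\<^sub>R P 0 + v k) \<circ> r) \<longlonglongrightarrow> x"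
    using seq_compactE[OF compact_imp_seq_compact[OF compact], of "\<lambda>k. s k *\<^sub>R P 0 + v k"] by metis
  have "(\<lambda>k. 1 - 1 / real (k + 2)) \<longlonglongrightarrow> 1 - 0"
    by (intro tendsto_intros LIMSEQ_ignore_initial_segment[OF lim_1_over_n])
  then have s1: "(\<lambda>k. s (r k)) \<longlonglongrightarrow> 1"
    using LIMSEQ_subseq_LIMSEQ[OF _ x(2), of s 1] by (simp add: s_def[abs_def] o_def)
  have "P i + (x - P 0) \<in> K" if i: "i < N" for i
  proof (rule closed_sequentially[OF closed])
    have "(\<lambda>k. s (r k) *\<^sub>R P i + ((s (r k) *\<^sub>R P 0 + v (r k)) - s (r k) *\<^sub>R P 0)) \<longlonglongrightarrow> 1 *\<^sub>R P i + (x - 1 *\<^sub>R P 0)"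
      using x(3) by (intro tendsto_intros s1) (simp add: o_def)
    then show "(\<lambda>k. s (r k) *\<^sub>R P i + v (r k)) \<longlonglongrightarrow> P i + (x - P 0)" by simp
    show "s (r k) *\<^sub>R P i + v (r k) \<in> K" for k using v[OF i] .
  qed
  then show thesis by (rule that)
qed

lemma cycle_length_translate:
  fixes P :: "nat \<Rightarrow> 'a"
  shows "cycle_length N (\<lambda>i. P i + v) = cycle_length N P"
  by (simp add: cycle_length_def)

text \<open>The contact weights define a linear functional \<open>A\<close> with
  \<open>A Q = 1\<close>, and every polygon on which \<open>A\<close> is at least 1 fails to fit. So
  \<open>Q\<close> is a critical point of the length on the hyperplane \<open>A = 1\<close>. Varying
  one vertex at a time in the multiplier equation gives the reflection law, with
  \<open>\<tau>\<close> equal to the weight times the total length.\<close>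

lemma shortest_cycle_reflection:
  assumes min: "shortest_cycle K N P"
  obtains Q \<tau> where "\<And>i. i < N \<Longrightarrow> Q i \<in> frontier K" "\<And>i. i < N \<Longrightarrow> Q (Suc i mod N) \<noteq> Q i"
    "\<And>i. i < N \<Longrightarrow> \<tau> i > 0" "cycle_length N Q = cycle_length N P"
    "\<And>i. i < N \<Longrightarrow> sgn (Q (Suc i mod N) - Q i) -
       sgn (Q (Suc (Suc i mod N) mod N) - Q (Suc i mod N)) = \<tau> (Suc i mod N) *\<^sub>R g (Q (Suc i mod N))"
proof -
  obtain v where v: "\<And>i. i < N \<Longrightarrow> P i + v \<in> K" using shortest_cycle_translate[OF min] by blast
  define Q where "Q i = P i + v" for i
  have QK: "Q i \<in> K" if "i < N" for i using v[OF that] by (simp add: Q_def)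
  have cQ: "cycle_length N Q = cycle_length N P" unfolding Q_def by (rule cycle_length_translate)
  define L where "L = cycle_length N Q"
  have L: "L > 0" and N: "N \<ge> 2" using shortest_cycle_positive[OF min] cQ by (auto simp: L_def)
  have nfQ: "\<not> fits_inside (Q ` {..<N}) K"
  proof
    assume "fits_inside (Q ` {..<N}) K"
    then obtain u where "\<forall>i<N. P i + v + u \<in> interior K" by (auto simp: fits_inside_def Q_def)
    then have "\<forall>x\<in>P ` {..<N}. x + (v + u) \<in> interior K" by (auto simp: add.assoc)
    then show False using min unfolding shortest_cycle_def fits_inside_def by blast
  qed
  have fewer: False if "\<not> fits_inside (R ` {..<N - 1}) K" "cycle_length (N - 1) R \<le> cycle_length N Q" for R
  proof -
    have "N - 1 \<le> DIM('a) + 1" "N - 1 < N" using min N by (auto simp: shortest_cycle_def)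
    then have "cycle_length N P < cycle_length (N - 1) R" using min that(1) unfolding shortest_cycle_def by blast
    then show False using that(2) cQ by simp
  qed
  have remove: "fits_inside (Q ` ({..<N} - {k})) K" if k: "k < N" for k
  proof -
    obtain R where R: "Q ` ({..<N} - {k}) \<subseteq> R ` {..<N - 1}" "cycle_length (N - 1) R \<le> cycle_length N Q"
      using remove_vertex[OF N k] by blast
    have "fits_inside (R ` {..<N - 1}) K" using fewer R(2) by blast
    then show ?thesis using R(1) by (rule fits_inside_mono) simp
  qed
  obtain l where l: "\<And>i. l i \<ge> 0" "(\<Sum>i<N. l i) = 1" "(\<Sum>i<N. l i *\<^sub>R g (Q i)) = 0"
    and fr: "\<And>i. i < N \<Longrightarrow> l i \<noteq> 0 \<Longrightarrow> Q i \<in> frontier K"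
    using contact_weights[OF QK nfQ] by blast
  note cert = weights_not_fits_inside[OF l fr]
  have lQ: "(\<Sum>i<N. l i * (g (Q i) \<bullet> Q i)) = 1"
  proof -
    have "(\<Sum>i<N. l i * (g (Q i) \<bullet> Q i)) = (\<Sum>i<N. l i)"
    proof (intro sum.cong refl)
      fix i assume "i \<in> {..<N}"
      then show "l i * (g (Q i) \<bullet> Q i) = l i" using grad_gauge(1)[OF fr[of i]] by (cases "l i = 0") auto
    qed
    then show ?thesis using l by simp
  qed
  \<comment> \<open>If a weight vanished, the remaining vertices would already fail to fit,
    contradicting the minimal number of vertices.\<close>
  have lnz: "l k \<noteq> 0" if k: "k < N" for k
  proof
    assume "l k = 0"
    then have "Q ` {i. i < N \<and> l i \<noteq> 0} \<subseteq> Q ` ({..<N} - {k})" by auto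
    then have "fits_inside (Q ` {i. i < N \<and> l i \<noteq> 0}) K" using fits_inside_mono[OF remove[OF k]] by blast
    then show False using cert[of Q] lQ by simp
  qed
  have lpos: "l k > 0" if "k < N" for k using lnz[OF that] l(1)[of k] by simp
  have S: "Suc i mod N < N" for i using N by simp
  have Sne: "Suc i mod N \<noteq> i" if "i < N" for i using N that by (cases "Suc i = N") auto
  \<comment> \<open>Distinct neighbours are what makes the length differentiable at
    \<open>Q\<close>.\<close>
  have ne: "Q (Suc k mod N) \<noteq> Q k" if k: "k < N" for k
  proof
    assume eq: "Q (Suc k mod N) = Q k"
    have "Q ` {..<N} \<subseteq> Q ` ({..<N} - {k})"
    proof
      fix x assume "x \<in> Q ` {..<N}"
      then obtain i where i: "i < N" "x = Q i" by blast
      show "x \<in> Q ` ({..<N} - {k})"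
      proof (cases "i = k")
        case True
        then show ?thesis using eq i Sne[OF k] S by (intro image_eqI[of _ _ "Suc k mod N"]) auto
      qed (use i in blast)
    qed
    then show False using fits_inside_mono[OF remove[OF k]] nfQ by blast
  qed
  define u where "u i = sgn (Q (Suc i mod N) - Q i)" for i
  \<comment> \<open>\<open>G\<close> is the first variation of the length at \<open>Q\<close>, and
    \<open>A\<close> the constraint functional.\<close>
  define G where "G w = (\<Sum>i<N. u i \<bullet> (w (Suc i mod N) - w i))" for w :: "nat \<Rightarrow> 'a"
  define A where "A w = (\<Sum>i<N. l i * (g (Q i) \<bullet> w i))" for w
  have A_lin: "A (\<lambda>i. x i + c *\<^sub>R y i) = A x + c * A y" for x y c
    by (simp add: A_def inner_add_right distrib_left sum.distrib sum_distrib_left mult.left_commute)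
  have AQ: "A Q = 1" using lQ by (simp add: A_def)
  have GQ: "G Q = L"
  proof -
    have "sgn x \<bullet> x = norm x" for x :: 'a
      by (cases "x = 0") (simp_all add: sgn_div_norm dot_square_norm power2_eq_square)
    then show ?thesis
      unfolding G_def L_def cycle_length_def u_def by (simp add: dist_norm norm_minus_commute)
  qed
  have G0: "G w = 0" if w: "A w = 0" for w
  proof (rule DERIV_local_min)
    show "((\<lambda>t. cycle_length N (\<lambda>i. Q i + t *\<^sub>R w i)) has_real_derivative G w) (at 0)"
    proof -
      have eq: "cycle_length N (\<lambda>i. Q i + t *\<^sub>R w i) =
          (\<Sum>i<N. norm ((Q (Suc i mod N) - Q i) + t *\<^sub>R (w (Suc i mod N) - w i)))" for t
        unfolding cycle_length_def by (intro sum.cong) (auto simp: dist_norm norm_minus_commute algebra_simps)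
      show ?thesis
        unfolding eq G_def u_def using ne by (intro DERIV_sum norm_line_derivative) auto
    qed
    show "\<forall>t. \<bar>0 - t\<bar> < 1 \<longrightarrow> cycle_length N (\<lambda>i. Q i + 0 *\<^sub>R w i) \<le> cycle_length N (\<lambda>i. Q i + t *\<^sub>R w i)"
    proof (intro allI impI)
      fix t
      have "A (\<lambda>i. Q i + t *\<^sub>R w i) = A Q + t * A w" by (rule A_lin)
      then have "\<not> fits_inside ((\<lambda>i. Q i + t *\<^sub>R w i) ` {i. i < N \<and> l i \<noteq> 0}) K"
        using w AQ by (intro cert) (auto simp: A_def)
      moreover have "{i. i < N \<and> l i \<noteq> 0} = {..<N}" using lnz by auto
      ultimately have "\<not> fits_inside ((\<lambda>i. Q i + t *\<^sub>R w i) ` {..<N}) K" by simp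
      then show "cycle_length N (\<lambda>i. Q i + 0 *\<^sub>R w i) \<le> cycle_length N (\<lambda>i. Q i + t *\<^sub>R w i)"
        using min cQ unfolding shortest_cycle_def by simp
    qed
  qed simp
  \<comment> \<open>Subtracting \<open>A w\<close> times \<open>Q\<close> moves \<open>w\<close>
    into the kernel of \<open>A\<close>. The multiplier is \<open>G Q\<close>, which is the length
    itself because length is homogeneous of degree one.\<close>
  have GA: "G w = L * A w" for w
  proof -
    have "A (\<lambda>i. w i + (- A w) *\<^sub>R Q i) = A w + (- A w) * A Q" by (rule A_lin)
    also have "\<dots> = 0" using AQ by simp
    finally have "G (\<lambda>i. w i + (- A w) *\<^sub>R Q i) = 0" by (rule G0)
    moreover have "G (\<lambda>i. w i + (- A w) *\<^sub>R Q i) = G w + (- A w) * G Q"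
      unfolding G_def sum_distrib_left sum.distrib[symmetric]
      by (intro sum.cong) (auto simp: algebra_simps inner_diff_right)
    ultimately show ?thesis using GQ by simp
  qed
  have inj: "Suc i mod N = Suc j mod N \<longleftrightarrow> i = j" if "i < N" "j < N" for i j
    using that by (auto simp: mod_Suc split: if_splits)
  have refl: "u j - u (Suc j mod N) = (L * l (Suc j mod N)) *\<^sub>R g (Q (Suc j mod N))" if j: "j < N" for j
  proof (rule vector_eq_ldot[THEN iffD1], rule allI)
    fix e :: 'a
    define k where "k = Suc j mod N"
    \<comment> \<open>Moving the single vertex \<open>k\<close> affects only the edge
      \<open>j\<close> entering it and the edge \<open>k\<close> leaving it.\<close>
    define w where "w i = (if i = k then e else 0)" for i
    have k: "k < N" using S by (simp add: k_def)
    have "G w = (\<Sum>i<N. u i \<bullet> w (Suc i mod N)) - (\<Sum>i<N. u i \<bullet> w i)"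
      by (simp add: G_def inner_diff_right sum_subtractf)
    also have "(\<Sum>i<N. u i \<bullet> w (Suc i mod N)) = (\<Sum>i<N. if i = j then u i \<bullet> e else 0)"
      using inj j by (intro sum.cong) (auto simp: w_def k_def)
    also have "\<dots> = u j \<bullet> e" using j by (simp add: sum.delta)
    also have "(\<Sum>i<N. u i \<bullet> w i) = (\<Sum>i<N. if i = k then u i \<bullet> e else 0)"
      by (intro sum.cong) (auto simp: w_def)
    also have "\<dots> = u k \<bullet> e" using k by (simp add: sum.delta)
    finally have Gw: "G w = u j \<bullet> e - u k \<bullet> e" .
    have "A w = (\<Sum>i<N. if i = k then l i * (g (Q i) \<bullet> e) else 0)"
      unfolding A_def by (intro sum.cong) (auto simp: w_def)
    also have "\<dots> = l k * (g (Q k) \<bullet> e)" using k by (simp add: sum.delta)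
    finally show "e \<bullet> (u j - u (Suc j mod N)) = e \<bullet> (L * l (Suc j mod N)) *\<^sub>R g (Q (Suc j mod N))"
      using GA[of w] Gw by (simp add: k_def inner_diff_right inner_commute)
  qed
  show thesis
  proof (rule that[of Q "\<lambda>i. L * l i"])
    show "Q i \<in> frontier K" if "i < N" for i using fr lnz that by blast
    show "L * l i > 0" if "i < N" for i using L lpos that by simp
    show "sgn (Q (Suc i mod N) - Q i) - sgn (Q (Suc (Suc i mod N) mod N) - Q (Suc i mod N)) =
        (L * l (Suc i mod N)) *\<^sub>R g (Q (Suc i mod N))" if "i < N" for i
      using refl[OF that] by (simp add: u_def)
  qed (use ne cQ in auto)
qed

end

section \<open>Piecewise linear loops\<close>

lemma Ck_on_eq_const:
  assumes "open U" "\<And>x. x \<in> U \<Longrightarrow> f x = c"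
  shows "Ck_on k f U"
  using assms(2)
proof (induction k arbitrary: f c)
  case 0
  then have "continuous_on U f = continuous_on U (\<lambda>_. c)" by (intro continuous_on_cong) auto
  then show ?case by simp
next
  case (Suc k)
  have "(f has_derivative (\<lambda>_. 0)) (at x)" if "x \<in> U" for x
    by (rule has_derivative_transform_within_open[OF has_derivative_const[of c] assms(1) that]) (use Suc.prems in simp)
  then have "f differentiable (at x)" "frechet_derivative f (at x) = (\<lambda>_. 0)" if "x \<in> U" for x
    using that frechet_derivative_at differentiableI by (metis, metis)
  then show ?case using Suc.IH[of _ 0] by simp
qed

text \<open>Directional derivatives of an affine map are constant, so \<open>Ck_on_eq_const\<close>
  settles all higher orders.\<close>

lemma smooth_on_affine:
  fixes f :: "real \<Rightarrow> 'a::real_normed_vector"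
  assumes U: "open U" and f: "\<And>x. x \<in> U \<Longrightarrow> f x = a + x *\<^sub>R b"
  shows "smooth_on f U"
  unfolding smooth_on_def
proof
  fix k
  have hd: "(f has_derivative (\<lambda>h. h *\<^sub>R b)) (at x)" if "x \<in> U" for x
  proof (rule has_derivative_transform_within_open[OF _ U that])
    show "((\<lambda>x. a + x *\<^sub>R b) has_derivative (\<lambda>h. h *\<^sub>R b)) (at x)"
      by (auto intro!: derivative_eq_intros)
  qed (use f in simp)
  then have *: "f differentiable (at x)" "frechet_derivative f (at x) = (\<lambda>h. h *\<^sub>R b)" if "x \<in> U" for x
    using that frechet_derivative_at differentiableI by (metis, metis)
  show "Ck_on k f U"
  proof (cases k)
    case 0
    have "continuous_on U f = continuous_on U (\<lambda>x. a + x *\<^sub>R b)" using f by (intro continuous_on_cong) auto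
    then show ?thesis using 0 by (simp add: continuous_intros)
  next
    case (Suc n)
    have "Ck_on n (\<lambda>x. frechet_derivative f (at x) v) U" for v
      by (rule Ck_on_eq_const[OF U, of _ "v *\<^sub>R b"]) (simp add: *)
    then show ?thesis using Suc * by simp
  qed
qed

lemma negligible_countable_real:
  assumes "countable (S :: real set)"
  shows "negligible S"
  using countable_imp_null_set_lborel[OF assms] by (simp add: negligible_iff_null_sets null_sets_completionI)

text \<open>For \<open>s\<close> the time elapsed since a phase of duration \<open>d\<close> began,
  this is the time spent in that phase so far. It lets \<open>arc\<close> be one sum over all
  phases, so that increments can be estimated term by term.\<close>

definition clamp_time :: "real \<Rightarrow> real \<Rightarrow> real" where
  "clamp_time d s = max 0 (min s d)"

lemma clamp_time_mono: "s \<le> t \<Longrightarrow> clamp_time d s \<le> clamp_time d t"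
  by (auto simp: clamp_time_def)

text \<open>The durations \<open>\<delta>\<close> are in units of time where the velocities are \<open>W\<close>; \<open>path\<close> rescales the period to 1.\<close>
locale linear_loop =
  fixes M :: nat and Z W :: "nat \<Rightarrow> 'b::real_normed_vector" and \<delta> :: "nat \<Rightarrow> real"
  assumes M: "M > 0" and \<delta>: "k < M \<Longrightarrow> \<delta> k > 0"
    and step: "k < M \<Longrightarrow> Z (Suc k) = Z k + \<delta> k *\<^sub>R W k" and closed: "Z M = Z 0"
begin

definition start where "start k = (\<Sum>j<k. \<delta> j)"
definition period where "period = start M"
definition arc where "arc s = Z 0 + (\<Sum>k<M. clamp_time (\<delta> k) (s - start k) *\<^sub>R W k)"
definition path where "path t = arc (period * frac t)"

lemma start_Suc: "start (Suc k) = start k + \<delta> k"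
  by (simp add: start_def)

lemma start_0: "start 0 = 0"
  by (simp add: start_def)

lemma start_mono: "i \<le> j \<Longrightarrow> j \<le> M \<Longrightarrow> start i \<le> start j"
  unfolding start_def using \<delta> by (intro sum_mono2) (auto simp: less_imp_le)

lemma start_less: "i < M \<Longrightarrow> start i < start (Suc i)"
  using \<delta> by (simp add: start_Suc)

lemma period_pos: "period > 0"
  using start_less[of 0] start_mono[of 1 M] M by (simp add: period_def start_0)

lemma corner: "j \<le> M \<Longrightarrow> Z j = Z 0 + (\<Sum>k<j. \<delta> k *\<^sub>R W k)"
  by (induction j) (auto simp: step)

lemma arc_phase:
  assumes j: "j < M" and s: "start j \<le> s" "s \<le> start (Suc j)"
  shows "arc s = Z j + (s - start j) *\<^sub>R W j"
proof -
  have 1: "clamp_time (\<delta> k) (s - start k) = \<delta> k" if "k < j" for k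
    using that start_mono[of "Suc k" j] j s \<delta>[of k] by (auto simp: clamp_time_def start_Suc)
  have 2: "clamp_time (\<delta> k) (s - start k) = 0" if "k \<in> {Suc j..<M}" for k
    using that start_mono[of "Suc j" k] s \<delta>[of k] by (auto simp: clamp_time_def)
  have 3: "clamp_time (\<delta> j) (s - start j) = s - start j" using s by (auto simp: clamp_time_def start_Suc)
  have M: "{..<M} = ({..<j} \<union> {j}) \<union> {Suc j..<M}" using j by auto
  have "(\<Sum>k<M. clamp_time (\<delta> k) (s - start k) *\<^sub>R W k) =
      (\<Sum>k<j. clamp_time (\<delta> k) (s - start k) *\<^sub>R W k) + clamp_time (\<delta> j) (s - start j) *\<^sub>R W j
      + (\<Sum>k\<in>{Suc j..<M}. clamp_time (\<delta> k) (s - start k) *\<^sub>R W k)"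
    unfolding M by (subst sum.union_disjoint, simp, simp, force, subst sum.union_disjoint) auto
  also have "\<dots> = (\<Sum>k<j. \<delta> k *\<^sub>R W k) + (s - start j) *\<^sub>R W j" using 1 2 3 by simp
  finally show ?thesis using corner[of j] j by (simp add: arc_def)
qed

text \<open>Only \<open>t = 1\<close> needs an argument: there \<open>frac\<close> jumps back to 0,
  and the closing condition \<open>Z M = Z 0\<close> makes both values agree.\<close>

lemma path_unit_interval:
  assumes "0 \<le> t" "t \<le> 1"
  shows "path t = arc (period * t)"
proof (cases "t = 1")
  case True
  obtain m where m: "M = Suc m" using M gr0_implies_Suc by blast
  have mM: "m < M" using m by simp
  have p: "period = start m + \<delta> m" unfolding period_def by (simp add: m start_Suc)
  have "arc period = Z m + \<delta> m *\<^sub>R W m"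
    using arc_phase[OF mM, of period] \<delta>[OF mM] by (simp add: p start_Suc)
  also have "\<dots> = Z (Suc m)" using step[OF mM] by simp
  also have "\<dots> = Z 0" using closed m by simp
  also have "Z 0 = arc 0" using arc_phase[of 0 0] M start_less[of 0] by (simp add: start_0)
  finally show ?thesis using True by (simp add: path_def)
qed (use assms in \<open>simp add: path_def frac_eq\<close>)

lemma loop_path: "loop path"
  by (simp add: loop_def path_def frac_1_eq)

lemma path_add_int: "path (t + of_int n) = path t"
  by (simp add: path_def frac_def)

text \<open>Both ends of the phase are included and the integer \<open>n\<close> is free. At a
  corner the two adjacent phases thus each give a formula, also when the corner falls on an integer
  time.\<close>

lemma path_phase:
  assumes j: "j < M" and s: "start j \<le> period * (t - of_int n)" "period * (t - of_int n) \<le> start (Suc j)"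
  shows "path t = Z j + (period * (t - of_int n) - start j) *\<^sub>R W j"
proof -
  have "0 \<le> start j" "start (Suc j) \<le> period"
    using start_mono[of 0 j] start_mono[of "Suc j" M] j by (auto simp: start_0 period_def)
  then have "0 \<le> period * (t - of_int n)" "period * (t - of_int n) \<le> period * 1" using s by auto
  then have "0 \<le> t - of_int n" "t - of_int n \<le> 1"
    using period_pos by (simp add: zero_le_mult_iff, simp only: mult_le_cancel_left_pos)
  then have "path (t - of_int n) = arc (period * (t - of_int n))" by (rule path_unit_interval)
  then show ?thesis using path_add_int[of "t - of_int n" n] arc_phase[OF j s] by simp
qed

lemma phase_exists:
  assumes "0 \<le> s" "s < period"
  shows "\<exists>j<M. start j \<le> s \<and> s < start (Suc j)"
proof -
  have "\<exists>j<m. start j \<le> s \<and> s < start (Suc j)" if "s < start m" "m \<le> M" for m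
    using that
  proof (induction m)
    case 0
    then show ?case using assms by (simp add: start_0)
  next
    case (Suc m)
    then show ?case by (cases "s < start m") (auto simp: not_less less_Suc_eq)
  qed
  then show ?thesis using assms by (auto simp: period_def)
qed

lemma phase_exists_left:
  assumes "0 < s" "s \<le> period"
  shows "\<exists>j<M. start j < s \<and> s \<le> start (Suc j)"
proof -
  have "\<exists>j<m. start j < s \<and> s \<le> start (Suc j)" if "s \<le> start m" "m \<le> M" for m
    using that
  proof (induction m)
    case 0
    then show ?case using assms by (simp add: start_0)
  next
    case (Suc m)
    then show ?case by (cases "s \<le> start m") (auto simp: not_le less_Suc_eq)
  qed
  then show ?thesis using assms by (auto simp: period_def)
qed

lemma path_line_derivative:
  "((\<lambda>t. Z j + (period * (t - of_int n) - start j) *\<^sub>R W j) has_vector_derivative period *\<^sub>R W j) (at t within A)"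
  unfolding has_vector_derivative_def by (auto intro!: derivative_eq_intros simp: algebra_simps)

text \<open>The case \<open>s = 0\<close> is the corner at which a phase begins; there only the
  right derivative is governed by this phase.\<close>

lemma path_right:
  "\<exists>j s. j < M \<and> 0 \<le> s \<and> s < \<delta> j \<and> path t = Z j + s *\<^sub>R W j \<and>
     (path has_vector_derivative period *\<^sub>R W j) (at_right t) \<and>
     (s > 0 \<longrightarrow> (path has_vector_derivative period *\<^sub>R W j) (at t))"
proof -
  define n where "n = \<lfloor>t\<rfloor>"
  have "0 \<le> period * (t - of_int n)" "period * (t - of_int n) < period * 1"
    using period_pos by (auto simp: n_def intro!: mult_strict_left_mono) linarith
  then obtain j where j: "j < M" "start j \<le> period * (t - of_int n)" "period * (t - of_int n) < start (Suc j)"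
    using phase_exists by auto
  define a b where "a = of_int n + start j / period" and "b = of_int n + start (Suc j) / period"
  have t: "a \<le> t" "t < b" using j period_pos by (auto simp: a_def b_def field_simps)
  have eq: "Z j + (period * (x - of_int n) - start j) *\<^sub>R W j = path x" if "a \<le> x" "x \<le> b" for x
    by (rule path_phase[OF j(1), symmetric]) (use that period_pos in \<open>auto simp: a_def b_def field_simps\<close>)
  have "(path has_vector_derivative period *\<^sub>R W j) (at t within {t..})"
    by (rule has_vector_derivative_transform_within[OF path_line_derivative[of j n], where d = "b - t"])
       (use t eq in \<open>auto simp: dist_real_def\<close>)
  then have "(path has_vector_derivative period *\<^sub>R W j) (at_right t)"
    by (rule has_vector_derivative_within_subset) auto
  moreover have "(path has_vector_derivative period *\<^sub>R W j) (at t)" if "a < t"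
    by (rule has_vector_derivative_transform_within_open[OF path_line_derivative[of j n], where S = "{a<..<b}"])
       (use t that eq in auto)
  moreover have "a < t" if "0 < period * (t - of_int n) - start j"
    using that period_pos by (auto simp: a_def field_simps)
  ultimately show ?thesis
    using j t eq[of t] by (intro exI[of _ j] exI[of _ "period * (t - of_int n) - start j"]) (auto simp: start_Suc)
qed

lemma path_left:
  "\<exists>j s. j < M \<and> 0 < s \<and> s \<le> \<delta> j \<and> path t = Z j + s *\<^sub>R W j \<and>
     (path has_vector_derivative period *\<^sub>R W j) (at_left t)"
proof -
  \<comment> \<open>Unlike the floor, this counts an integer time as the end of the preceding
    period.\<close>
  define n where "n = \<lceil>t\<rceil> - 1"
  have "0 < t - of_int n" "t - of_int n \<le> 1" unfolding n_def by linarith+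
  then have "0 < period * (t - of_int n)" "period * (t - of_int n) \<le> period"
    using period_pos by (auto simp: mult_le_cancel_left2)
  then obtain j where j: "j < M" "start j < period * (t - of_int n)" "period * (t - of_int n) \<le> start (Suc j)"
    using phase_exists_left by blast
  define a b where "a = of_int n + start j / period" and "b = of_int n + start (Suc j) / period"
  have t: "a < t" "t \<le> b" using j period_pos by (auto simp: a_def b_def field_simps)
  have eq: "Z j + (period * (x - of_int n) - start j) *\<^sub>R W j = path x" if "a \<le> x" "x \<le> b" for x
    by (rule path_phase[OF j(1), symmetric]) (use that period_pos in \<open>auto simp: a_def b_def field_simps\<close>)
  have "(path has_vector_derivative period *\<^sub>R W j) (at t within {..t})"
    by (rule has_vector_derivative_transform_within[OF path_line_derivative[of j n], where d = "t - a"])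
       (use t eq in \<open>auto simp: dist_real_def\<close>)
  then have "(path has_vector_derivative period *\<^sub>R W j) (at_left t)"
    by (rule has_vector_derivative_within_subset) auto
  then show ?thesis
    using j t eq[of t] by (intro exI[of _ j] exI[of _ "period * (t - of_int n) - start j"]) (auto simp: start_Suc)
qed

lemma smooth_near:
  assumes "\<And>j n. j < M \<Longrightarrow> t \<noteq> of_int n + start j / period"
  shows "\<exists>U. open U \<and> t \<in> U \<and> smooth_on path U"
proof -
  define n where "n = \<lfloor>t\<rfloor>"
  have "0 \<le> period * (t - of_int n)" "period * (t - of_int n) < period * 1"
    using period_pos by (auto simp: n_def intro!: mult_strict_left_mono) linarith
  then obtain j where j: "j < M" "start j \<le> period * (t - of_int n)" "period * (t - of_int n) < start (Suc j)"
    using phase_exists by auto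
  define a b where "a = of_int n + start j / period" and "b = of_int n + start (Suc j) / period"
  have t: "a \<le> t" "t < b" "t \<noteq> a" using j period_pos assms[OF j(1)] by (auto simp: a_def b_def field_simps)
  have "path x = (Z j - (period * of_int n + start j) *\<^sub>R W j) + x *\<^sub>R (period *\<^sub>R W j)" if "a \<le> x" "x \<le> b" for x
    using path_phase[OF j(1), of x n] that period_pos by (auto simp: a_def b_def field_simps)
  then have "smooth_on path {a<..<b}"
    by (intro smooth_on_affine[of _ _ "Z j - (period * of_int n + start j) *\<^sub>R W j" "period *\<^sub>R W j"]) auto
  then show ?thesis using t by (intro exI[of _ "{a<..<b}"]) auto
qed

lemma piecewise_smooth_path: "piecewise_smooth path"
  unfolding piecewise_smooth_def
proof (intro conjI allI)
  show 1: "\<exists>D. (path has_vector_derivative D) (at_left t)" for t using path_left[of t] by blast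
  show 2: "\<exists>D. (path has_vector_derivative D) (at_right t)" for t using path_right[of t] by blast
  have "isCont path t" for t
  proof -
    have "continuous (at_left t) path" "continuous (at_right t) path"
      using 1[of t] 2[of t] has_vector_derivative_continuous by auto
    then show ?thesis unfolding continuous_at_split by simp
  qed
  then show "continuous_on UNIV path" by (simp add: continuous_on_eq_continuous_at)
  have "{t. \<not> (\<exists>U. open U \<and> t \<in> U \<and> smooth_on path U)} \<subseteq> (\<lambda>(j, n). of_int n + start j / period) ` ({..<M} \<times> (UNIV :: int set))"
  proof
    fix t assume "t \<in> {t. \<not> (\<exists>U. open U \<and> t \<in> U \<and> smooth_on path U)}"
    then obtain j n where "j < M" "t = of_int n + start j / period" using smooth_near[of t] by auto
    then show "t \<in> (\<lambda>(j, n). of_int n + start j / period) ` ({..<M} \<times> (UNIV :: int set))"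
      by (intro image_eqI[of _ _ "(j, n)"]) auto
  qed
  then show "negligible {t. \<not> (\<exists>U. open U \<and> t \<in> U \<and> smooth_on path U)}"
    by (rule negligible_subset[rotated]) (intro negligible_countable_real countable_image countable_SIGMA, auto)
qed

text \<open>Each phase contributes a multiple of \<open>h (W k)\<close> whose coefficient grows with
  time, so the bound is an increment of one monotone function. The linear map \<open>h\<close> is
  there for the projection to the position.\<close>

lemma dist_arc_le:
  assumes h: "bounded_linear h" and "s \<le> t"
  shows "norm (h (arc t) - h (arc s)) \<le> (\<Sum>k<M. clamp_time (\<delta> k) (t - start k) * norm (h (W k))) -
    (\<Sum>k<M. clamp_time (\<delta> k) (s - start k) * norm (h (W k)))"
proof -
  interpret bounded_linear h by (rule h)
  have "h (arc t) - h (arc s) = (\<Sum>k<M. (clamp_time (\<delta> k) (t - start k) - clamp_time (\<delta> k) (s - start k)) *\<^sub>R h (W k))"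
    by (simp add: arc_def add sum scaleR sum_subtractf scaleR_diff_left)
  also have "norm \<dots> \<le> (\<Sum>k<M. (clamp_time (\<delta> k) (t - start k) - clamp_time (\<delta> k) (s - start k)) * norm (h (W k)))"
    by (rule order_trans[OF norm_sum], intro sum_mono)
       (use clamp_time_mono[of "s - start k" "t - start k" "\<delta> k" for k] \<open>s \<le> t\<close> in simp)
  finally show ?thesis by (simp add: sum_subtractf left_diff_distrib)
qed

text \<open>Distances along the loop are bounded by increments of the monotone function
  \<open>V\<close>, so the length of any inscribed polygon telescopes. An upper bound suffices,
  since the lower bound for trajectories is already known.\<close>

lemma loop_length_path_le:
  fixes h :: "'b \<Rightarrow> 'c::real_normed_vector"
  assumes h: "bounded_linear h"
  shows "loop_length (\<lambda>t. h (path t)) \<le> ennreal (\<Sum>k<M. \<delta> k * norm (h (W k)))"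
  unfolding loop_length_def
proof (rule SUP_least)
  define V where "V t = (\<Sum>k<M. clamp_time (\<delta> k) (period * t - start k) * norm (h (W k)))" for t
  define q where "q t = h (path t)" for t
  have V: "dist (q s) (q t) \<le> V t - V s" if "0 \<le> s" "s \<le> t" "t \<le> 1" for s t
    using dist_arc_le[OF h, of "period * s" "period * t"] period_pos that
    by (simp add: q_def V_def path_unit_interval dist_norm norm_minus_commute)
  have V0: "V 0 \<ge> 0" unfolding V_def by (intro sum_nonneg) (auto simp: clamp_time_def)
  have V1: "V 1 \<le> (\<Sum>k<M. \<delta> k * norm (h (W k)))"
    unfolding V_def by (intro sum_mono mult_right_mono) (auto simp: clamp_time_def less_imp_le \<delta>)
  have Vm: "V s \<le> V t" if "s \<le> t" for s t
    unfolding V_def using that period_pos by (intro sum_mono mult_right_mono clamp_time_mono) auto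
  fix ts :: "real list" assume "ts \<in> {ts. sorted ts \<and> set ts \<subseteq> {0..1}}"
  then have ts: "sorted ts" "set ts \<subseteq> {0..1}" by auto
  have in01: "ts ! i \<in> {0..1}" if "i < length ts" for i using ts(2) that nth_mem by blast
  have "(\<Sum>i<length ts - 1. dist (q (ts ! i)) (q (ts ! Suc i))) \<le> (\<Sum>i<length ts - 1. V (ts ! Suc i) - V (ts ! i))"
    using ts in01 by (intro sum_mono V) (auto simp: sorted_iff_nth_Suc)
  also have "\<dots> = V (ts ! (length ts - 1)) - V (ts ! 0)" by (rule sum_lessThan_telescope)
  also have "\<dots> \<le> (\<Sum>k<M. \<delta> k * norm (h (W k)))"
  proof (cases "ts = []")
    case False
    then show ?thesis using Vm[of 0 "ts ! 0"] Vm[of "ts ! (length ts - 1)" 1] V0 V1 in01[of 0] in01[of "length ts - 1"] by simp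
  qed (auto intro!: sum_nonneg simp: less_imp_le \<delta>)
  finally show "(\<Sum>i<length ts - 1. ennreal (dist (h (path (ts ! i))) (h (path (ts ! Suc i)))))
      \<le> ennreal (\<Sum>k<M. \<delta> k * norm (h (W k)))"
    by (simp add: q_def sum_ennreal ennreal_leI)
qed

end

section \<open>Shortest polygons as billiard trajectories\<close>

lemma sum_even_odd:
  fixes f :: "nat \<Rightarrow> real"
  shows "(\<Sum>k<2 * n. f k) = (\<Sum>i<n. f (2 * i) + f (Suc (2 * i)))"
  by (induction n) (auto simp: numeral_2_eq_2)

text \<open>The shortest cycle is a billiard orbit. It is lifted to phase space by letting the momentum move
  along the gradient of the gauge at each bounce and stay constant on each edge.\<close>
lemma (in billiard_table) closed_trajectory_along_shortest_cycle:
  assumes min: "shortest_cycle K N P"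
  shows "\<exists>\<gamma>. closed_billiard_trajectory K \<gamma> \<and> loop_length (\<lambda>t. fst (\<gamma> t)) \<le> ennreal (cycle_length N P)"
proof -
  obtain Q \<tau> where Q: "\<And>i. i < N \<Longrightarrow> Q i \<in> frontier K" and ne: "\<And>i. i < N \<Longrightarrow> Q (Suc i mod N) \<noteq> Q i"
    and \<tau>: "\<And>i. i < N \<Longrightarrow> \<tau> i > 0" and len: "cycle_length N Q = cycle_length N P"
    and refl: "\<And>i. i < N \<Longrightarrow> sgn (Q (Suc i mod N) - Q i) -
       sgn (Q (Suc (Suc i mod N) mod N) - Q (Suc i mod N)) = \<tau> (Suc i mod N) *\<^sub>R g (Q (Suc i mod N))"
    using shortest_cycle_reflection[OF min] by blast
  have N: "N > 0" using shortest_cycle_positive[OF min] by simp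
  define u where "u i = sgn (Q (Suc i mod N) - Q i)" for i
  \<comment> \<open>Phase \<open>2 i\<close> is the bounce at vertex \<open>i + 1\<close>, taking
    the momentum from \<open>- u i\<close> to \<open>- u (i + 1)\<close>; phase
    \<open>2 i + 1\<close> is the flight from vertex \<open>i + 1\<close> to vertex
    \<open>i + 2\<close>. The minus sign comes from the equation of motion, where the position moves
    against the momentum.\<close>
  define Z where "Z k = (Q (Suc (k div 2) mod N), - u ((if even k then k div 2 else Suc (k div 2)) mod N))" for k
  define W where "W k = (if even k then (0, g (Q (Suc (k div 2) mod N))) else (u (Suc (k div 2) mod N), 0))" for k
  define \<delta> where "\<delta> k = (if even k then \<tau> (Suc (k div 2) mod N)
    else dist (Q (Suc (k div 2) mod N)) (Q (Suc (Suc (k div 2) mod N) mod N)))" for k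
  have S: "i mod N < N" for i using N by simp
  have u1: "norm (u i) = 1" if "i < N" for i using ne[OF that] by (simp add: u_def norm_sgn)
  have dpos: "\<delta> k > 0" for k 
    using \<tau>[OF S, of "Suc (k div 2)"] ne[OF S, of "Suc (k div 2)", symmetric] by (simp add: \<delta>_def)
  have step: "Z (Suc k) = Z k + \<delta> k *\<^sub>R W k" if k: "k < 2 * N" for k
  proof (cases "even k")
    case True
    then obtain i where i: "k = 2 * i" "i < N" using k by (auto elim: evenE)
    then show ?thesis using refl[OF i(2)] by (simp add: Z_def W_def \<delta>_def u_def algebra_simps)
  next
    case False
    then obtain i where i: "k = Suc (2 * i)" by (auto elim: oddE)
    have n: "dist x y *\<^sub>R sgn (y - x) = y - x" for x y :: 'a
      by (cases "x = y") (auto simp: sgn_div_norm dist_norm norm_minus_commute)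
    show ?thesis
      unfolding i using n[of "Q (Suc i mod N)" "Q (Suc (Suc i mod N) mod N)"]
      by (simp add: Z_def W_def \<delta>_def u_def mod_Suc_eq)
  qed
  have closedZ: "Z (2 * N) = Z 0" by (simp add: Z_def mod_Suc_eq[of N N, symmetric] mod_Suc)
  interpret linear_loop "2 * N" Z W \<delta>
    by unfold_locales (use N dpos step closedZ in auto)
  have B: "frontier (cball 0 1 :: 'a set) = {p. norm p = 1}" by (auto simp: sphere_def dist_norm)
  have Zc: "Z k \<in> frontier K \<times> frontier (cball 0 1)" for k
    using Q[OF S] u1[OF S] unfolding B by (auto simp: Z_def)
  have frK: "frontier K \<subseteq> K" using billiard_table_axioms billiard_table.closed frontier_subset_closed by blast
  have in_body: "Z k + s *\<^sub>R W k \<in> K \<times> cball 0 1" if "k < 2 * N" "0 \<le> s" "s \<le> \<delta> k" for k s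
  proof -
    have Zin: "Z k \<in> K \<times> cball 0 1" for k using Zc[of k] frK B by auto
    \<comment> \<open>A point of a phase is a convex combination of the two adjacent corners, so
      convexity of the product bounds position and momentum at once.\<close>
    have "Z k + s *\<^sub>R W k = (1 - s / \<delta> k) *\<^sub>R Z k + (s / \<delta> k) *\<^sub>R Z (Suc k)"
      using dpos[of k] by (simp add: step[OF that(1)] algebra_simps)
    then show ?thesis
      using convexD_alt[OF convex_Times[OF convex convex_cball] Zin[of k] Zin[of "Suc k"], of "s / \<delta> k"] that dpos[of k] by simp
  qed
  have even: "fst (Z k + s *\<^sub>R W k) \<in> frontier K" "W k = (0, g (fst (Z k + s *\<^sub>R W k)))" if "even k" for k s
    using that Q[OF S, of "Suc (k div 2)"] by (simp_all add: Z_def W_def)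
  have odd: "norm (snd (Z k + s *\<^sub>R W k)) = 1" "W k = (- grad norm (snd (Z k + s *\<^sub>R W k)), 0)" if "odd k" for k s
    using that u1[OF S, of "Suc (k div 2)"] by (simp_all add: Z_def W_def grad_norm_unit)
  have in_frontier: "Z k + s *\<^sub>R W k \<in> frontier (K \<times> cball 0 1)" if "k < 2 * N" "0 \<le> s" "s \<le> \<delta> k" for k s
  proof -
    have "Z k + s *\<^sub>R W k \<notin> interior (K \<times> cball 0 1)"
      using even(1)[of k s] odd(1)[of k s] by (cases "even k") (auto simp: interior_Times mem_Times_iff frontier_def)
    moreover have "Z k + s *\<^sub>R W k \<in> closure (K \<times> cball 0 1)" using in_body[OF that] closure_subset by (rule rev_subsetD)
    ultimately show ?thesis unfolding frontier_def by (rule DiffI[rotated])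
  qed
  \<comment> \<open>With \<open>s\<close> unrestricted, this serves the start, the middle and the
    end of a phase alike, so both one-sided derivatives are covered wherever the path meets both
    boundaries.\<close>
  have cone: "period *\<^sub>R W k \<in> billiard_cone K (Z k + s *\<^sub>R W k)" for k s
  proof -
    define z where "z = Z k + s *\<^sub>R W k"
    consider "W k = (0, g (fst z))" | "W k = (- grad norm (snd z), 0)"
      using even(2)[of k s] odd(2)[of k s] unfolding z_def by blast
    then have "period *\<^sub>R W k \<in> billiard_cone K z"
    proof cases
      case 1
      then have "period *\<^sub>R W k = 0 *\<^sub>R (- grad norm (snd z), 0) + period *\<^sub>R (0, g (fst z))" by simp
      then show ?thesis using period_pos unfolding billiard_cone_def by fastforce
    next
      case 2
      then have "period *\<^sub>R W k = period *\<^sub>R (- grad norm (snd z), 0) + 0 *\<^sub>R (0, g (fst z))" by simp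
      then show ?thesis using period_pos unfolding billiard_cone_def by fastforce
    qed
    then show ?thesis by (simp add: z_def)
  qed
  \<comment> \<open>Each phase starts at a point of both boundaries; away from such points the path
    is past the start of its phase and has a two-sided derivative.\<close>
  have corner: "s > 0" if "k < 2 * N" "0 \<le> s" "Z k + s *\<^sub>R W k \<notin> frontier K \<times> frontier (cball 0 1)" for k s
    using that Zc[of k] by (cases "s = 0") auto
  have inside: "W k = (- grad norm (snd (Z k + s *\<^sub>R W k)), 0)" if "Z k + s *\<^sub>R W k \<in> interior K \<times> frontier (cball 0 1)" for k s
    using that even(1)[of k s] odd(2)[of k s] by (cases "even k") (auto simp: mem_Times_iff frontier_def)
  have bounce: "W k = (0, g (fst (Z k + s *\<^sub>R W k)))" if "Z k + s *\<^sub>R W k \<in> frontier K \<times> interior (cball 0 1)" for k s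
    using that even(2)[of k s] odd(1)[of k s] by (cases "even k") (auto simp: mem_Times_iff)
  have "closed_billiard_trajectory K path"
    unfolding closed_billiard_trajectory_def
  proof (intro conjI allI impI loop_path piecewise_smooth_path)
    fix t
    show "path t \<in> frontier (K \<times> cball 0 1)" using path_right[of t] in_frontier by (metis less_imp_le)
  next
    \<comment> \<open>Rescaling the period to 1 multiplies all velocities by \<open>period\<close>,
      which serves as the constant \<open>d\<close>.\<close>
    have "(path t \<in> interior K \<times> frontier (cball 0 1) \<longrightarrow>
           (path has_vector_derivative period *\<^sub>R (- grad norm (snd (path t)), 0)) (at t)) \<and>
        (path t \<in> frontier K \<times> interior (cball 0 1) \<longrightarrow>
           (path has_vector_derivative period *\<^sub>R (0, g (fst (path t)))) (at t))"
      if nc: "path t \<notin> frontier K \<times> frontier (cball 0 1)" for t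
    proof -
      obtain k s where k: "k < 2 * N" "0 \<le> s" "path t = Z k + s *\<^sub>R W k"
        and d: "s > 0 \<Longrightarrow> (path has_vector_derivative period *\<^sub>R W k) (at t)"
        using path_right[of t] by blast
      have "(path has_vector_derivative period *\<^sub>R W k) (at t)" using d corner[OF k(1,2)] nc k(3) by simp
      then show ?thesis using inside[of k s] bounce[of k s] k(3) by metis
    qed
    then show "\<exists>d>0. \<forall>t. path t \<notin> frontier K \<times> frontier (cball 0 1) \<longrightarrow>
        (path t \<in> interior K \<times> frontier (cball 0 1) \<longrightarrow>
           (path has_vector_derivative d *\<^sub>R (- grad norm (snd (path t)), 0)) (at t)) \<and>
        (path t \<in> frontier K \<times> interior (cball 0 1) \<longrightarrow>
           (path has_vector_derivative d *\<^sub>R (0, g (fst (path t)))) (at t))"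
      using period_pos by blast
  next
    fix t
    show "\<exists>D\<in>billiard_cone K (path t). (path has_vector_derivative D) (at_left t)"
      using path_left[of t] cone by metis
    show "\<exists>D\<in>billiard_cone K (path t). (path has_vector_derivative D) (at_right t)"
      using path_right[of t] cone by metis
  qed
  moreover have "(\<Sum>k<2 * N. \<delta> k * norm (fst (W k))) = cycle_length N P"
  proof -
    have "(\<Sum>k<2 * N. \<delta> k * norm (fst (W k))) = (\<Sum>i<N. dist (Q (Suc i mod N)) (Q (Suc (Suc i mod N) mod N)))"
      unfolding sum_even_odd using u1[OF S] by (intro sum.cong) (auto simp: W_def \<delta>_def)
    also have "\<dots> = cycle_length N (\<lambda>i. Q ((i + 1) mod N))"
      unfolding cycle_length_def by (intro sum.cong) auto
    finally show ?thesis using len by (simp only: cycle_length_rotate)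
  qed
  ultimately show ?thesis
    using loop_length_path_le[OF bounded_linear_fst] by (intro exI[of _ path]) simp
qed

section \<open>Independence of the origin and the value of \<open>xi\<close>\<close>

lemma fits_inside_diff_translation:
  "fits_inside S ((\<lambda>y. y - x) ` K) \<longleftrightarrow> fits_inside S K"
proof -
  have mem: "y \<in> (\<lambda>y. y - x) ` interior K \<longleftrightarrow> y + x \<in> interior K" for y
    by (auto intro!: image_eqI[of _ _ "y + x"])
  show ?thesis
  proof
    assume "fits_inside S ((\<lambda>y. y - x) ` K)"
    then obtain v where "\<forall>y\<in>S. y + (v + x) \<in> interior K"
      by (auto simp: fits_inside_def interior_diff_translation mem add.assoc)
    then show "fits_inside S K" unfolding fits_inside_def by blast
  next
    assume "fits_inside S K"
    then obtain v where "\<forall>y\<in>S. y + v \<in> interior K" by (auto simp: fits_inside_def)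
    then have "\<forall>y\<in>S. y + (v - x) \<in> interior ((\<lambda>y. y - x) ` K)"
      by (simp add: interior_diff_translation mem algebra_simps)
    then show "fits_inside S ((\<lambda>y. y - x) ` K)" unfolding fits_inside_def by blast
  qed
qed

lemma shortest_cycle_diff_translation:
  "shortest_cycle ((\<lambda>y. y - x) ` K) N P \<longleftrightarrow> shortest_cycle K N P"
  by (simp add: shortest_cycle_def fits_inside_diff_translation)

lemma loop_frac:
  assumes "loop f"
  shows "f (frac t) = f t"
proof (cases "\<lfloor>t\<rfloor> \<ge> 0")
  case True
  then show ?thesis using loop_add_nat[OF assms, of "frac t" "nat \<lfloor>t\<rfloor>"] by (simp add: frac_def)
next
  case False
  then show ?thesis using loop_add_nat[OF assms, of t "nat (- \<lfloor>t\<rfloor>)"] by (simp add: frac_def)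
qed

lemma loop_length_diff_const:
  fixes q :: "real \<Rightarrow> 'a::real_normed_vector"
  shows "loop_length (\<lambda>t. q t - x) = loop_length q"
  by (simp add: loop_length_def dist_norm)

lemma shortest_cycle_le_trajectory:
  fixes K :: "'a::euclidean_space set"
  assumes K: "smooth_convex_body K" and min: "shortest_cycle K N P" and q: "periodic_billiard_trajectory K q"
  shows "ennreal (cycle_length N P) \<le> loop_length q"
proof -
  obtain x p where x: "x \<in> interior K"
    and tr: "closed_billiard_trajectory ((\<lambda>y. y - x) ` K) (\<lambda>t. (q t - x, p t))"
    using q unfolding periodic_billiard_trajectory_def by blast
  interpret billiard_table "(\<lambda>y. y - x) ` K" by (rule billiard_table_translation[OF K x])
  have lp: "loop (\<lambda>t. (q t - x, p t))" using tr by (simp add: closed_billiard_trajectory_def)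
  then have lq: "loop (\<lambda>t. q t - x)" by (simp add: loop_def)
  have "range (\<lambda>t. q t - x) \<subseteq> (\<lambda>t. q t - x) ` {0..1}"
  proof
    fix y assume "y \<in> range (\<lambda>t. q t - x)"
    then obtain t where "y = q t - x" by blast
    then show "y \<in> (\<lambda>t. q t - x) ` {0..1}"
      using loop_frac[OF lq, of t] frac_lt_1[of t] by (intro image_eqI[of _ _ "frac t"]) (auto simp: less_imp_le)
  qed
  moreover have "\<not> fits_inside (range (\<lambda>t. q t - x)) ((\<lambda>y. y - x) ` K)"
    using closed_trajectory_not_fits_inside[OF tr] by simp
  ultimately have "\<not> fits_inside ((\<lambda>t. q t - x) ` {0..1}) ((\<lambda>y. y - x) ` K)"
    using fits_inside_mono[OF _ _ order_refl] by meson
  moreover have "q 0 - x = q 1 - x" using lq[unfolded loop_def, rule_format, of 0] by simp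
  moreover have "shortest_cycle ((\<lambda>y. y - x) ` K) N P" using min by (simp add: shortest_cycle_diff_translation)
  ultimately have "ennreal (cycle_length N P) \<le> loop_length (\<lambda>t. q t - x)"
    by (intro shortest_cycle_le_loop_length)
  then show ?thesis by (simp add: loop_length_diff_const)
qed

text \<open>The constructed trajectory is at most as long as the shortest cycle, and no trajectory
  is shorter than that cycle. Hence its length is exactly this value and the least element
  exists.\<close>

lemma xi_eq_shortest_cycle:
  fixes K :: "'a::euclidean_space set"
  assumes K: "smooth_convex_body K" and min: "shortest_cycle K N P"
  shows "xi K = ennreal (cycle_length N P)"
  unfolding xi_def
proof (rule Least_equality)
  obtain x where x: "x \<in> interior K" using K by (auto simp: smooth_convex_body_def convex_body_def)
  interpret billiard_table "(\<lambda>y. y - x) ` K" by (rule billiard_table_translation[OF K x])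
  have "shortest_cycle ((\<lambda>y. y - x) ` K) N P" using min by (simp add: shortest_cycle_diff_translation)
  then obtain \<gamma> where \<gamma>: "closed_billiard_trajectory ((\<lambda>y. y - x) ` K) \<gamma>"
    "loop_length (\<lambda>t. fst (\<gamma> t)) \<le> ennreal (cycle_length N P)"
    using closed_trajectory_along_shortest_cycle by blast
  define q where "q t = fst (\<gamma> t) + x" for t
  have "closed_billiard_trajectory ((\<lambda>y. y - x) ` K) (\<lambda>t. (q t - x, snd (\<gamma> t)))"
    using \<gamma>(1) by (simp add: q_def)
  then have tr: "periodic_billiard_trajectory K q"
    unfolding periodic_billiard_trajectory_def using x by (intro bexI[of _ x] exI[of _ "\<lambda>t. snd (\<gamma> t)"])
  have "loop_length q \<le> ennreal (cycle_length N P)"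
    using \<gamma>(2) loop_length_diff_const[of q x] by (simp add: q_def)
  then have "ennreal (cycle_length N P) = loop_length q"
    using shortest_cycle_le_trajectory[OF K min tr] by (rule order_antisym[rotated])
  then show "\<exists>q. periodic_billiard_trajectory K q \<and> ennreal (cycle_length N P) = loop_length q"
    using tr by blast
next
  fix l assume "\<exists>q. periodic_billiard_trajectory K q \<and> l = loop_length q"
  then show "ennreal (cycle_length N P) \<le> l" using shortest_cycle_le_trajectory[OF K min] by blast
qed

theorem proposition1p4:
  fixes K1 K2 :: "'a::euclidean_space set"
  assumes "smooth_convex_body K1" and "smooth_convex_body K2" and "K1 \<subseteq> K2"
  shows "xi K1 \<le> xi K2"
proof -
  have "bounded K1" "bounded K2"
    using assms by (auto simp: smooth_convex_body_def convex_body_def compact_imp_bounded)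
  then obtain N1 P1 N2 P2 where min: "shortest_cycle K1 N1 P1" "shortest_cycle K2 N2 P2"
    using shortest_cycle_exists by metis
  have "\<not> fits_inside (P2 ` {..<N2}) K1"
    using min(2) fits_inside_mono[OF _ order_refl interior_mono[OF assms(3)]]
    unfolding shortest_cycle_def by blast
  then have "cycle_length N1 P1 \<le> cycle_length N2 P2"
    using min unfolding shortest_cycle_def by blast
  then show ?thesis
    using xi_eq_shortest_cycle[OF assms(1) min(1)] xi_eq_shortest_cycle[OF assms(2) min(2)] by (simp add: ennreal_leI)
qed

end
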